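(* Let $(X,\sigma)$ be a shift and suppose there exists $k\in\mathbb{N}$ such that $$\limsup_{n\to\infty}\frac{P_X(n)}{n}<k.$$ Then every finitely generated subgroup of $\mathrm{Aut}(X)$ is virtually $\mathbb{Z}^d$ for some integer $d<k$ (that is, it contains a finite index subgroup isomorphic to $\mathbb{Z}^d$, where $d\ge 0$ may depend on the subgroup).
   Context: Let $\mathcal{A}$ be a finite alphabet with the discrete topology, give $\mathcal{A}^{\mathbb{Z}}$ the product topology, and let $\sigma\colon\mathcal{A}^{\mathbb{Z}}\to\mathcal{A}^{\mathbb{Z}}$ be the left shift $(\sigma x)(n)=x(n+1)$. A shift $(X,\sigma)$ is a closed set $X\subseteq\mathcal{A}^{\mathbb{Z}}$ with $\sigma(X)=X$. $\mathrm{Aut}(X)$ is the group of homeomorphisms of $X$ to itself that commute with $\sigma$. The complexity function $P_X(n)$ is the number of words $w=(a_0,\dots,a_{n-1})\in\mathcal{A}^n$ for which there is $x\in X$ with $x(i)=a_i$ for all $0\le i<n$. A group $G$ is virtually $H$ if it contains a subgroup of finite index isomorphic to $H$. *)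

theory Defs
  imports "HOL-Analysis.Analysis" "HOL-Algebra.Bij" "HOL-Algebra.Product_Groups"
begin

section \<open>Shifts\<close>

definition full_shift :: "'a set \<Rightarrow> (int \<Rightarrow> 'a) topology" where
  "full_shift A = product_topology (\<lambda>_. discrete_topology A) UNIV"

definition left_shift :: "(int \<Rightarrow> 'a) \<Rightarrow> (int \<Rightarrow> 'a)" where
  "left_shift x = (\<lambda>n. x (n + 1))"

definition is_shift :: "'a set \<Rightarrow> (int \<Rightarrow> 'a) set \<Rightarrow> bool" where
  "is_shift A X \<longleftrightarrow> finite A \<and> closedin (full_shift A) X \<and> left_shift ` X = X"

definition complexity :: "'a set \<Rightarrow> (int \<Rightarrow> 'a) set \<Rightarrow> nat \<Rightarrow> nat" where
  "complexity A X n =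
     card {w \<in> lists A. length w = n \<and> (\<exists>x\<in>X. \<forall>i<n. x (int i) = w ! i)}"


section \<open>The automorphism group\<close>

text \<open>
  As in \<^const>\<open>AutoGroup\<close>, self-maps of \<open>X\<close> are represented by extensional functions, so that two
  automorphisms are equal iff they agree on \<open>X\<close>.
\<close>

definition shift_auts :: "'a set \<Rightarrow> (int \<Rightarrow> 'a) set \<Rightarrow> ((int \<Rightarrow> 'a) \<Rightarrow> (int \<Rightarrow> 'a)) set" where
  "shift_auts A X =
     {f \<in> Bij X.
        homeomorphic_map (subtopology (full_shift A) X) (subtopology (full_shift A) X) f \<and>
        (\<forall>x\<in>X. f (left_shift x) = left_shift (f x))}"

definition Aut_shift :: "'a set \<Rightarrow> (int \<Rightarrow> 'a) set \<Rightarrow> ((int \<Rightarrow> 'a) \<Rightarrow> (int \<Rightarrow> 'a)) monoid" where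
  "Aut_shift A X = BijGroup X \<lparr>carrier := shift_auts A X\<rparr>"

lemma topspace_shift:
  assumes "is_shift A X"
  shows "topspace (subtopology (full_shift A) X) = X"
  using assms closedin_subset by (fastforce simp: is_shift_def)

lemma subgroup_shift_auts:
  assumes "is_shift A X"
  shows "subgroup (shift_auts A X) (BijGroup X)"
proof (rule subgroup.intro)
  let ?T = "subtopology (full_shift A) X"
  note top = topspace_shift[OF assms]
  have sh: "left_shift x \<in> X" if "x \<in> X" for x
    using assms that by (auto simp: is_shift_def)
  show "shift_auts A X \<subseteq> carrier (BijGroup X)"
    by (auto simp: shift_auts_def BijGroup_def)
  show "f \<otimes>\<^bsub>BijGroup X\<^esub> g \<in> shift_auts A X"
    if f: "f \<in> shift_auts A X" and g: "g \<in> shift_auts A X" for f g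
  proof -
    have B: "f \<in> Bij X" "g \<in> Bij X" using f g by (auto simp: shift_auts_def)
    have gX: "g x \<in> X" if "x \<in> X" for x using Bij_imp_funcset[OF B(2)] that by auto
    have "homeomorphic_map ?T ?T (f \<circ> g)"
      using f g by (auto simp: shift_auts_def intro: homeomorphic_map_compose)
    then have "homeomorphic_map ?T ?T (compose X f g)"
      by (rule homeomorphic_map_eq) (auto simp: top compose_def)
    then show ?thesis
      using f g B gX sh by (auto simp: shift_auts_def BijGroup_def compose_Bij compose_eq)
  qed
  show "\<one>\<^bsub>BijGroup X\<^esub> \<in> shift_auts A X"
  proof -
    have "homeomorphic_map ?T ?T id" by simp
    then have "homeomorphic_map ?T ?T (\<lambda>x\<in>X. x)"
      by (rule homeomorphic_map_eq) (auto simp: top)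
    then show ?thesis using sh by (auto simp: shift_auts_def BijGroup_def id_Bij)
  qed
  show "inv\<^bsub>BijGroup X\<^esub> f \<in> shift_auts A X" if f: "f \<in> shift_auts A X" for f
  proof -
    have B: "f \<in> Bij X" and hf: "homeomorphic_map ?T ?T f"
      and comm: "\<And>x. x \<in> X \<Longrightarrow> f (left_shift x) = left_shift (f x)"
      using f by (auto simp: shift_auts_def)
    have bij: "bij_betw f X X" using B by (simp add: Bij_def)
    let ?g = "\<lambda>x\<in>X. inv_into X f x"
    obtain h where h: "homeomorphic_maps ?T ?T f h"
      using hf homeomorphic_map_maps by blast
    have hX: "h x \<in> X" "f (h x) = x" if "x \<in> X" for x
      using h that continuous_map_image_subset_topspace[of ?T ?T h]
      unfolding homeomorphic_maps_def top by blast+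
    have eq: "h x = inv_into X f x" if "x \<in> X" for x
      using bij_betw_inv_into_left[OF bij hX(1)[OF that]] hX(2)[OF that] by simp
    have "homeomorphic_map ?T ?T h"
      using h homeomorphic_map_maps homeomorphic_maps_sym by blast
    then have hg: "homeomorphic_map ?T ?T ?g"
      by (rule homeomorphic_map_eq) (use top eq in auto)
    have "inv_into X f (left_shift x) = left_shift (inv_into X f x)" if "x \<in> X" for x
      using bij_betw_inv_into_left[OF bij sh[OF hX(1)[OF that]]] comm[OF hX(1)[OF that]]
        hX(2)[OF that] eq[OF that] by simp
    then show ?thesis
      using hg sh B by (simp add: inv_BijGroup[OF B] shift_auts_def restrict_inv_into_Bij)
  qed
qed

lemma group_Aut_shift: "is_shift A X \<Longrightarrow> group (Aut_shift A X)"
  unfolding Aut_shift_def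
  by (rule subgroup.subgroup_is_group[OF subgroup_shift_auts group_BijGroup])


section \<open>Finitely generated and virtually free abelian groups\<close>

definition finitely_generated_subgroup :: "'g set \<Rightarrow> ('g, 'm) monoid_scheme \<Rightarrow> bool" where
  "finitely_generated_subgroup H G \<longleftrightarrow>
     subgroup H G \<and> (\<exists>S. finite S \<and> S \<subseteq> carrier G \<and> H = generate G S)"

definition virtually :: "('g, 'm) monoid_scheme \<Rightarrow> ('h, 'n) monoid_scheme \<Rightarrow> bool" where
  "virtually G H \<longleftrightarrow>
     (\<exists>K. subgroup K G \<and> finite (rcosets\<^bsub>G\<^esub> K) \<and> G\<lparr>carrier := K\<rparr> \<cong> H)"

definition int_power_group :: "nat \<Rightarrow> (nat \<Rightarrow> int) monoid" where
  "int_power_group d = product_group {..<d} (\<lambda>_. integer_group)"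

end

theory Submission
  imports Defs
begin

text \<open>
  Linear complexity bounds the number of nonperiodic points none of which lies in the orbit closure
  of its predecessors, so the nonperiodic points are in the closure of the orbits of fewer than \<open>k\<close>
  points \<open>y i\<close>. Counting special words shows that the images of \<open>y i\<close> under automorphisms lie in
  finitely many shift orbits. A finite index subgroup of the given group \<open>H\<close> therefore acts on each
  \<open>y i\<close> by a power of the shift, which gives a homomorphism to \<open>\<int>\<^sup>m\<close> with \<open>m < k\<close>.

  An element of its kernel fixes all nonperiodic points. All but finitely many periodic points look
  locally like the \<open>y i\<close>, on a scale that exceeds the range of the generators; the generators move
  their locally nonperiodic pieces like the \<open>y i\<close>, hence the kernel fixes them. Passing to the
  finite index subgroup that fixes the remaining finitely many points makes the homomorphism
  injective, and subgroups of \<open>\<int>\<^sup>m\<close> are free abelian of rank at most \<open>m\<close>.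
\<close>

section \<open>Periodic points, block codes and automorphisms\<close>

text \<open>\<open>X\<close> may contain infinitely many periodic points outside the closure of the
  nonperiodic ones, so displacements on the \<open>y i\<close> say nothing by themselves about those
  points. This is where finite generation enters: finitely many generators have a common range, so
  only patterns up to a fixed scale matter, and at that scale only finitely many periodic points
  differ from the \<open>y i\<close>. Schreier's argument keeps the subgroup acting by shifts
  finitely generated.

  The limsup bounds the complexity but not its increments, which are small only at some levels.
  Allowing increments up to \<open>3 * k\<close> puts such a level into every interval
  \<open>{n..n + n div 2}\<close> with \<open>n\<close> large, and these levels are close enough
  together for agreement on a window to spread from each to the next. A point with
  \<open>3 * k + 1\<close> images in distinct orbits is therefore isolated in \<open>X\<close>, and
  its images would form a family that is too large.\<close>

definition sh :: "int \<Rightarrow> (int \<Rightarrow> 'a) \<Rightarrow> (int \<Rightarrow> 'a)" where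
  "sh j x = (\<lambda>n. x (n + j))"

lemma sh_apply [simp]: "sh j x n = x (n + j)"
  by (simp add: sh_def)

lemma sh_0 [simp]: "sh 0 x = x"
  by (simp add: sh_def)

lemma sh_sh [simp]: "sh i (sh j x) = sh (i + j) x"
  by (simp add: sh_def fun_eq_iff algebra_simps)

lemma left_shift_eq_sh: "left_shift = sh 1"
  by (simp add: left_shift_def sh_def fun_eq_iff)

definition periodic :: "(int \<Rightarrow> 'a) \<Rightarrow> bool" where
  "periodic x \<longleftrightarrow> (\<exists>q>0. sh q x = x)"

lemma sh_mult:
  assumes "sh q x = x"
  shows "sh (j * q) x = x"
proof -
  have nat: "sh (int n * q) x = x" for n
  proof (induction n)
    case (Suc n)
    have "sh (int (Suc n) * q) x = sh (int n * q) (sh q x)"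
      by (simp add: algebra_simps)
    with Suc assms show ?case by simp
  qed simp
  have "sh (- (int n * q)) x = x" for n
    using nat[of n] by (metis sh_sh add.left_inverse sh_0)
  with nat show ?thesis
    by (cases j rule: int_cases2) (auto simp: mult_minus_left)
qed

lemma sh_eq_imp_periodic:
  assumes "sh a x = sh b x" "a \<noteq> b"
  shows "periodic x"
proof -
  have "sh (b - a) x = x" "sh (a - b) x = x"
    using arg_cong[OF assms(1), of "sh (-a)"] arg_cong[OF assms(1), of "sh (-b)"] by simp_all
  then show ?thesis
    using assms(2) unfolding periodic_def
    by (meson diff_gt_0_iff_gt linorder_neqE)
qed

lemma periodic_sh_iff [simp]: "periodic (sh j x) \<longleftrightarrow> periodic x"
proof -
  have "sh q (sh j x) = sh j x \<longleftrightarrow> sh q x = x" for q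
    by (metis add.commute add.right_inverse sh_0 sh_sh)
  then show ?thesis by (simp only: periodic_def)
qed

text \<open>Periodicity makes a half-line as good as the line: a large multiple of a period moves
  any coordinate beyond \<open>a\<close>. Later arguments then need to extend identities to the
  right only.\<close>

lemma sh_eq_of_right_period:
  assumes per: "periodic x" and q: "\<And>t. t \<ge> a \<Longrightarrow> x (t + q) = x t"
  shows "sh q x = x"
proof
  fix t
  from per obtain p where p: "p > 0" "sh p x = x" by (auto simp: periodic_def)
  let ?j = "\<bar>a\<bar> + \<bar>t\<bar>"
  have *: "x (s + ?j * p) = x s" for s
    using fun_cong[OF sh_mult[OF p(2), of ?j], of s] by simp
  have "?j * 1 \<le> ?j * p" using p(1) by (intro mult_left_mono) auto
  moreover have "t + ?j \<ge> a" by linarith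
  ultimately have "t + ?j * p \<ge> a" by simp
  from q[OF this] show "sh q x t = x t"
    using *[of t] *[of "t + q"] by (simp add: algebra_simps)
qed

lemma periodic_eqI_right:
  assumes "periodic x" "periodic y" "\<And>t. t \<ge> a \<Longrightarrow> x t = y t"
  shows "x = y"
proof
  fix t
  from assms obtain p q where p: "p > 0" "sh p x = x" and q: "q > 0" "sh q y = y"
    by (auto simp: periodic_def)
  let ?j = "\<bar>a\<bar> + \<bar>t\<bar>"
  have "x (t + ?j * q * p) = x t" using fun_cong[OF sh_mult[OF p(2), of "?j * q"], of t] by simp
  moreover have "y (t + ?j * p * q) = y t" using fun_cong[OF sh_mult[OF q(2), of "?j * p"], of t] by simp
  moreover have "?j * 1 \<le> ?j * (p * q)" using mult_pos_pos[OF p(1) q(1)] by (intro mult_left_mono) auto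
  then have "t + ?j * q * p \<ge> a" by (simp add: algebra_simps)
  ultimately show "x t = y t" using assms(3)[of "t + ?j * q * p"] by (simp add: algebra_simps)
qed

text \<open>A bound on the dependence instead of a rule on words; commuting with \<open>sh\<close>
  is kept apart. \<open>r\<close> is an integer, and a negative one makes \<open>f x t\<close>
  independent of \<open>x\<close>.\<close>

definition block_code :: "(int \<Rightarrow> 'a) set \<Rightarrow> int \<Rightarrow> ((int \<Rightarrow> 'a) \<Rightarrow> (int \<Rightarrow> 'a)) \<Rightarrow> bool" where
  "block_code X r f \<longleftrightarrow>
     (\<forall>x\<in>X. \<forall>y\<in>X. \<forall>t. (\<forall>s\<in>{t - r..t + r}. x s = y s) \<longrightarrow> f x t = f y t)"

lemma block_codeD:
  "\<lbrakk>block_code X r f; x \<in> X; y \<in> X; \<And>s. \<lbrakk>t - r \<le> s; s \<le> t + r\<rbrakk> \<Longrightarrow> x s = y s\<rbrakk> \<Longrightarrow> f x t = f y t"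
  unfolding block_code_def by (metis atLeastAtMost_iff)

lemma block_code_mono: "block_code X r f \<Longrightarrow> r \<le> r' \<Longrightarrow> block_code X r' f"
  unfolding block_code_def by (meson atLeastAtMost_iff diff_left_mono add_left_mono order_trans)

section \<open>Closedness and compactness of a subshift\<close>

locale subshift =
  fixes A :: "'a set" and X :: "(int \<Rightarrow> 'a) set"
  assumes shift: "is_shift A X"
begin

lemma finite_alphabet: "finite A"
  using shift by (simp add: is_shift_def)

lemma symbol_in: "x \<in> X \<Longrightarrow> x n \<in> A"
  using shift closedin_subset unfolding is_shift_def full_shift_def by fastforce

lemma sh_in: assumes "x \<in> X" shows "sh j x \<in> X"
proof -
  have im: "left_shift ` X = X" using shift by (simp add: is_shift_def)
  have pos: "sh (int n) x \<in> X" if "x \<in> X" for n x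
  proof (induction n)
    case (Suc n)
    have "sh (int (Suc n)) x = left_shift (sh (int n) x)"
      by (simp add: left_shift_eq_sh algebra_simps)
    with Suc im show ?case by blast
  qed (use that in simp)
  have neg: "sh (- int n) x \<in> X" for n
  proof (induction n)
    case (Suc n)
    then obtain y where y: "y \<in> X" "sh (- int n) x = left_shift y" using im by blast
    then have "sh (- int (Suc n)) x = sh (-1) (left_shift y)" by (metis add.commute minus_add_distrib of_nat_Suc sh_sh)
    also have "\<dots> = y" by (simp add: left_shift_eq_sh)
    finally show ?case using y by simp
  qed (use assms in simp)
  show ?thesis using pos[OF assms] neg by (cases j rule: int_cases2) auto
qed

lemma sh_in_iff [simp]: "sh j x \<in> X \<longleftrightarrow> x \<in> X"
  using sh_in[of "sh j x" "-j"] sh_in by auto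

text \<open>A basic neighbourhood of \<open>y\<close> constrains finitely many coordinates only, so
  a large enough window decides whether it meets the closed set \<open>X\<close>.\<close>

lemma in_if_windows_in:
  assumes "\<And>N. \<exists>x\<in>X. \<forall>t\<in>{-N..N}. x t = y t"
  shows "y \<in> X"
proof (rule ccontr)
  assume nin: "y \<notin> X"
  have yA: "y \<in> topspace (full_shift A)"
  proof -
    have "y t \<in> A" for t
      using assms[of "\<bar>t\<bar>"] symbol_in by (metis abs_ge_minus_self abs_ge_self abs_le_iff atLeastAtMost_iff minus_le_iff)
    then show ?thesis by (auto simp: full_shift_def)
  qed
  have "openin (full_shift A) (topspace (full_shift A) - X)"
    using shift by (auto simp: is_shift_def closedin_def)
  then obtain U where U: "finite {i. U i \<noteq> A}" "y \<in> Pi\<^sub>E UNIV U" "Pi\<^sub>E UNIV U \<subseteq> topspace (full_shift A) - X"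
    using yA nin unfolding full_shift_def openin_product_topology_alt by (simp) blast
  define N where "N = Max (insert 0 (abs ` {i. U i \<noteq> A}))"
  have N: "i \<in> {-N..N}" if "U i \<noteq> A" for i
  proof -
    have "\<bar>i\<bar> \<le> N" unfolding N_def using U(1) that by (intro Max_ge) auto
    then show ?thesis by auto
  qed
  obtain x where x: "x \<in> X" "\<forall>t\<in>{-N..N}. x t = y t" using assms by blast
  have "x i \<in> U i" for i
  proof (cases "U i = A")
    case False
    then show ?thesis using N[OF False] x(2) U(2) by (metis PiE_mem UNIV_I)
  qed (use symbol_in[OF x(1)] in simp)
  then have "x \<in> Pi\<^sub>E UNIV U" by auto
  with U(3) x(1) show False by blast
qed

text \<open>Compactness by a diagonal argument: finitely many words fill a window, so infinitely
  many indices survive each enlargement. Counting indices instead of naming a subsequence lets later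
  proofs pick an index that is also as large as they wish.\<close>

lemma cluster_point:
  fixes x :: "nat \<Rightarrow> int \<Rightarrow> 'a"
  assumes x: "\<And>n. x n \<in> X"
  obtains y where "y \<in> X" "\<And>N. infinite {n. \<forall>t\<in>{-N..N}. x n t = y t}"
proof -
  let ?P = "\<lambda>N y. infinite {n. \<forall>t\<in>{-int N..int N}. x n t = y t}"
  have ext: "\<exists>z. infinite {n\<in>I. \<forall>t\<in>{-int N..int N}. x n t = z t}" if "infinite I" for I :: "nat set" and N
  proof -
    let ?f = "\<lambda>n. restrict (x n) {-int N..int N}"
    have "?f ` I \<subseteq> {-int N..int N} \<rightarrow>\<^sub>E A" using symbol_in[OF x] by auto
    then have "finite (?f ` I)"
      by (rule finite_subset) (auto intro!: finite_PiE finite_alphabet)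
    from pigeonhole_infinite[OF that this] obtain a where a: "a \<in> I" "infinite {n\<in>I. ?f n = ?f a}" by auto
    have "{n\<in>I. ?f n = ?f a} \<subseteq> {n\<in>I. \<forall>t\<in>{-int N..int N}. x n t = x a t}"
      by (auto simp: fun_eq_iff restrict_def)
    with a show ?thesis using infinite_super by blast
  qed
  have "\<exists>y. \<forall>N. ?P N (y N) \<and> (\<forall>t\<in>{-int N..int N}. y (Suc N) t = y N t)"
  proof (rule dependent_nat_choice)
    show "\<exists>y. ?P 0 y" using ext[of UNIV 0] by auto
  next
    fix y N assume "?P N y"
    from ext[OF this, of "Suc N"] obtain z where z: "infinite {n\<in>{n. \<forall>t\<in>{-int N..int N}. x n t = y t}. \<forall>t\<in>{-int (Suc N)..int (Suc N)}. x n t = z t}"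
      by blast
    then have "?P (Suc N) z" by (rule infinite_super[rotated]) auto
    moreover obtain n where "\<forall>t\<in>{-int N..int N}. x n t = y t" "\<forall>t\<in>{-int (Suc N)..int (Suc N)}. x n t = z t"
      using infinite_imp_nonempty[OF z] by blast
    then have "\<forall>t\<in>{-int N..int N}. z t = y t" by auto
    ultimately show "\<exists>z. ?P (Suc N) z \<and> (\<forall>t\<in>{-int N..int N}. z t = y t)" by blast
  qed
  then obtain y where y: "\<And>N. ?P N (y N)" "\<And>N t. t \<in> {-int N..int N} \<Longrightarrow> y (Suc N) t = y N t" by blast
  have mono: "y (N + k) t = y N t" if "t \<in> {-int N..int N}" for N k t
    using that by (induction k) (auto simp: y(2))
  \<comment> \<open>The diagonal limit: the choice at coordinate \<open>t\<close> no longer changes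
    from stage \<open>nat \<bar>t\<bar>\<close> on.\<close>
  define z where "z t = y (nat \<bar>t\<bar>) t" for t
  have z: "z t = y N t" if "t \<in> {-int N..int N}" for N t
  proof -
    have "nat \<bar>t\<bar> \<le> N" "t \<in> {-int (nat \<bar>t\<bar>)..int (nat \<bar>t\<bar>)}" using that by auto
    then show ?thesis using mono[of t "nat \<bar>t\<bar>" "N - nat \<bar>t\<bar>"] by (simp add: z_def)
  qed
  have inf: "infinite {n. \<forall>t\<in>{-N..N}. x n t = z t}" for N
  proof (rule infinite_super)
    show "infinite {n. \<forall>t\<in>{-int (nat N)..int (nat N)}. x n t = y (nat N) t}" by (rule y)
    show "{n. \<forall>t\<in>{-int (nat N)..int (nat N)}. x n t = y (nat N) t} \<subseteq> {n. \<forall>t\<in>{-N..N}. x n t = z t}"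
    proof safe
      fix n t assume n: "\<forall>t\<in>{-int (nat N)..int (nat N)}. x n t = y (nat N) t" and "t \<in> {-N..N}"
      then have "t \<in> {-int (nat N)..int (nat N)}" by auto
      with n z show "x n t = z t" by metis
    qed
  qed
  have "z \<in> X"
  proof (rule in_if_windows_in)
    fix N
    obtain n where "\<forall>t\<in>{-N..N}. x n t = z t" using infinite_imp_nonempty[OF inf[of N]] by blast
    then show "\<exists>x\<in>X. \<forall>t\<in>{-N..N}. x t = z t" using x by blast
  qed
  with inf that show thesis by blast
qed

section \<open>Automorphisms as block codes\<close>

abbreviation "aut \<equiv> Aut_shift A X"

lemma group_aut: "group aut"
  by (rule group_Aut_shift[OF shift])

lemma carrier_aut: "carrier aut = shift_auts A X"
  by (simp add: Aut_shift_def)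

lemma aut_in: "f \<in> carrier aut \<Longrightarrow> x \<in> X \<Longrightarrow> f x \<in> X"
  using Bij_imp_funcset unfolding carrier_aut shift_auts_def by blast

lemma aut_mult: "f \<in> carrier aut \<Longrightarrow> g \<in> carrier aut \<Longrightarrow> x \<in> X \<Longrightarrow> (f \<otimes>\<^bsub>aut\<^esub> g) x = f (g x)"
  by (simp add: carrier_aut shift_auts_def Aut_shift_def BijGroup_def compose_eq)

lemma aut_one: "x \<in> X \<Longrightarrow> \<one>\<^bsub>aut\<^esub> x = x"
  by (simp add: Aut_shift_def BijGroup_def)

lemma aut_eqI:
  assumes "f \<in> carrier aut" "g \<in> carrier aut" "\<And>x. x \<in> X \<Longrightarrow> f x = g x"
  shows "f = g"
proof -
  have "f \<in> extensional X" "g \<in> extensional X"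
    using assms Bij_imp_extensional unfolding carrier_aut shift_auts_def by blast+
  then show ?thesis using assms(3) by (rule extensionalityI)
qed

lemma aut_inv_left: "f \<in> carrier aut \<Longrightarrow> x \<in> X \<Longrightarrow> (inv\<^bsub>aut\<^esub> f) (f x) = x"
  using aut_mult[of "inv\<^bsub>aut\<^esub> f" f x] group_aut aut_one by (simp add: group.inv_closed group.l_inv)

lemma aut_inv_right: "f \<in> carrier aut \<Longrightarrow> x \<in> X \<Longrightarrow> f ((inv\<^bsub>aut\<^esub> f) x) = x"
  using aut_mult[of f "inv\<^bsub>aut\<^esub> f" x] group_aut aut_one by (simp add: group.inv_closed group.r_inv)

lemma aut_sh: assumes f: "f \<in> carrier aut" and x: "x \<in> X" shows "f (sh j x) = sh j (f x)"
proof -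
  have 1: "f (sh 1 x) = sh 1 (f x)" if "x \<in> X" for x
    using f that by (simp add: carrier_aut shift_auts_def left_shift_eq_sh)
  have pos: "f (sh (int n) x) = sh (int n) (f x)" if "x \<in> X" for n x
  proof (induction n)
    case (Suc n)
    have "f (sh (int (Suc n)) x) = f (sh 1 (sh (int n) x))" by (simp only: sh_sh) simp
    also have "\<dots> = sh 1 (sh (int n) (f x))" by (simp only: 1 Suc sh_in_iff that)
    also have "\<dots> = sh (int (Suc n)) (f x)" by (simp only: sh_sh) simp
    finally show ?case .
  qed simp
  have "f (sh (- int n) x) = sh (- int n) (f x)" for n
  proof -
    have "f x = sh (int n) (f (sh (- int n) x))" using pos[of "sh (- int n) x" n] x by simp
    then show ?thesis by (metis add.left_inverse sh_0 sh_sh)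
  qed
  then show ?thesis using pos[OF x] by (cases j rule: int_cases2) auto
qed

lemma aut_periodic_iff: assumes f: "f \<in> carrier aut" and x: "x \<in> X"
  shows "sh q (f x) = f x \<longleftrightarrow> sh q x = x"
  by (metis aut_sh aut_inv_left f x sh_in_iff)

text \<open>If every range failed, recentring would give pairs \<open>x n\<close>,
  \<open>y n\<close> that agree on growing windows but have images differing at 0. Both approach a
  cluster point \<open>z\<close>, where continuity of \<open>f\<close> forces the images to
  agree.\<close>

lemma curtis_hedlund_lyndon:
  assumes f: "f \<in> carrier aut"
  shows "\<exists>r. block_code X r f"
proof (rule ccontr)
  assume no: "\<nexists>r. block_code X r f"
  have "\<exists>x y. x \<in> X \<and> y \<in> X \<and> (\<forall>s\<in>{-int n..int n}. x s = y s) \<and> f x 0 \<noteq> f y 0" for n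
  proof -
    have "\<not> block_code X (int n) f" using no by blast
    then obtain x y t where "x \<in> X" "y \<in> X" "\<forall>s\<in>{t - int n..t + int n}. x s = y s" "f x t \<noteq> f y t"
      unfolding block_code_def by blast
    then show ?thesis
      by (intro exI[of _ "sh t x"] exI[of _ "sh t y"]) (auto simp: aut_sh[OF f])
  qed
  then obtain x y where xy: "\<And>n. x n \<in> X" "\<And>n. y n \<in> X" "\<And>n. \<forall>s\<in>{-int n..int n}. x n s = y n s"
      "\<And>n. f (x n) 0 \<noteq> f (y n) 0" by metis
  from cluster_point[of x] xy(1) obtain z where z: "z \<in> X" "\<And>N. infinite {n. \<forall>t\<in>{-N..N}. x n t = z t}" by blast
  have top: "topspace (subtopology (full_shift A) X) = X" using topspace_shift shift by blast
  have cont: "continuous_map (subtopology (full_shift A) X) (full_shift A) f"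
    using f homeomorphic_imp_continuous_map continuous_map_in_subtopology
    unfolding carrier_aut shift_auts_def by blast
  have proj: "continuous_map (full_shift A) (discrete_topology A) (\<lambda>g. g 0)"
    unfolding full_shift_def by (rule continuous_map_product_projection) simp
  have "continuous_map (subtopology (full_shift A) X) (discrete_topology A) (\<lambda>x. f x 0)"
    using continuous_map_compose[OF cont proj] by (simp add: o_def)
  then have "openin (subtopology (full_shift A) X) {x \<in> topspace (subtopology (full_shift A) X). f x 0 \<in> {f z 0}}"
    by (rule openin_continuous_map_preimage) (simp add: symbol_in[OF aut_in[OF f z(1)]])
  then have "openin (subtopology (full_shift A) X) {x \<in> X. f x 0 \<in> {f z 0}}"
    by (simp only: top)
  then obtain V where V: "openin (full_shift A) V" "{x \<in> X. f x 0 \<in> {f z 0}} = V \<inter> X"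
    by (auto simp: openin_subtopology)
  then have "z \<in> V" using z(1) by blast
  then obtain U where U: "finite {i. U i \<noteq> A}" "z \<in> Pi\<^sub>E UNIV U" "Pi\<^sub>E UNIV U \<subseteq> V"
    using V(1) unfolding full_shift_def openin_product_topology_alt by simp blast
  define N where "N = Max (insert 0 (abs ` {i. U i \<noteq> A}))"
  have N: "i \<in> {-N..N}" if "U i \<noteq> A" for i
  proof -
    have "\<bar>i\<bar> \<le> N" unfolding N_def using U(1) that by (intro Max_ge) auto
    then show ?thesis by auto
  qed
  have nbhd: "f w 0 = f z 0" if w: "w \<in> X" "\<forall>t\<in>{-N..N}. w t = z t" for w
  proof -
    have "w i \<in> U i" for i
    proof (cases "U i = A")
      case False
      then show ?thesis using N[OF False] w(2) U(2) by (metis PiE_mem UNIV_I)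
    qed (use symbol_in[OF w(1)] in simp)
    then have "w \<in> V \<inter> X" using U(3) w(1) by auto
    with V(2) show ?thesis by auto
  qed
  \<comment> \<open>\<open>n\<close> is at least \<open>N\<close>, so that \<open>y n\<close> shares
    the whole window with \<open>x n\<close> and is close to \<open>z\<close> too.\<close>
  obtain n where n: "n \<ge> nat N" "\<forall>t\<in>{-N..N}. x n t = z t"
    using z(2)[of N] unfolding infinite_nat_iff_unbounded_le by blast
  have "f (x n) 0 = f z 0" by (rule nbhd[OF xy(1) n(2)])
  moreover have "f (y n) 0 = f z 0"
  proof (rule nbhd[OF xy(2)], intro ballI)
    fix t assume "t \<in> {-N..N}"
    moreover from this n(1) have "t \<in> {-int n..int n}" by auto
    ultimately show "y n t = z t" using n(2) xy(3)[of n] by metis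
  qed
  ultimately show False using xy(4)[of n] by simp
qed

end

section \<open>Words and complexity\<close>

definition word :: "(int \<Rightarrow> 'a) \<Rightarrow> int \<Rightarrow> nat \<Rightarrow> 'a list" where
  "word x t n = map (\<lambda>i. x (t + int i)) [0..<n]"

lemma length_word [simp]: "length (word x t n) = n"
  by (simp add: word_def)

lemma word_nth [simp]: "i < n \<Longrightarrow> word x t n ! i = x (t + int i)"
  by (simp add: word_def)

lemma word_sh [simp]: "word (sh j x) t n = word x (t + j) n"
  by (simp add: word_def algebra_simps)

lemma word_eq_iff: "word x s n = word y t n \<longleftrightarrow> (\<forall>u\<in>{0..<int n}. x (s + u) = y (t + u))"
proof -
  have "word x s n = word y t n \<longleftrightarrow> (\<forall>i<n. x (s + int i) = y (t + int i))"
    by (simp add: list_eq_iff_nth_eq)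
  also have "\<dots> \<longleftrightarrow> (\<forall>u\<in>{0..<int n}. x (s + u) = y (t + u))"
    by (metis atLeastLessThan_iff nonneg_int_cases of_nat_0_le_iff of_nat_less_iff)
  finally show ?thesis .
qed

lemma take_word: "m \<le> n \<Longrightarrow> take m (word x t n) = word x t m"
  by (simp add: word_def take_map)

lemma drop_word: "drop m (word x t n) = word x (t + int m) (n - m)"
  by (rule nth_equalityI) (auto simp: algebra_simps)

text \<open>For a shift invariant set, reading words at position 0 captures every position.\<close>

definition language :: "(int \<Rightarrow> 'a) set \<Rightarrow> nat \<Rightarrow> 'a list set" where
  "language X n = (\<lambda>x. word x 0 n) ` X"

definition right_special :: "(int \<Rightarrow> 'a) set \<Rightarrow> nat \<Rightarrow> 'a list set" where
  "right_special X n = {word x 0 n |x. x \<in> X \<and> (\<exists>y\<in>X. word y 0 n = word x 0 n \<and> y (int n) \<noteq> x (int n))}"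

text \<open>A section \<open>g\<close> of \<open>f\<close> and, over each point of \<open>D\<close>,
  a second preimage \<open>h d\<close> off the section occupy disjoint parts of
  \<open>U\<close>.\<close>

lemma card_image_doubled:
  assumes "finite U" "D \<subseteq> f ` U" "\<And>d. d \<in> D \<Longrightarrow> \<exists>u\<in>U. \<exists>v\<in>U. u \<noteq> v \<and> f u = d \<and> f v = d"
  shows "card (f ` U) + card D \<le> card U"
proof -
  have "\<forall>v\<in>f ` U. \<exists>u. u \<in> U \<and> f u = v" by blast
  then obtain g where g: "\<And>v. v \<in> f ` U \<Longrightarrow> g v \<in> U \<and> f (g v) = v" by metis
  have "\<exists>u\<in>U. u \<noteq> g d \<and> f u = d" if "d \<in> D" for d using assms(3)[OF that] by metis
  then obtain h where h: "\<And>d. d \<in> D \<Longrightarrow> h d \<in> U \<and> h d \<noteq> g d \<and> f (h d) = d" by metis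
  have fin: "finite (f ` U)" "finite D" using assms finite_subset by blast+
  have "inj_on g (f ` U)" "inj_on h D" using g h by (metis inj_onI)+
  have disj: "g ` f ` U \<inter> h ` D = {}"
  proof -
    have "g v \<noteq> h d" if "v \<in> f ` U" "d \<in> D" for v d
    proof
      assume "g v = h d"
      then have "v = d" using g[OF that(1)] h[OF that(2)] by metis
      with \<open>g v = h d\<close> h[OF that(2)] show False by simp
    qed
    then show ?thesis by blast
  qed
  from \<open>inj_on g (f ` U)\<close> \<open>inj_on h D\<close> have "card (f ` U) + card D = card (g ` f ` U) + card (h ` D)" by (simp add: card_image)
  also have "\<dots> = card (g ` f ` U \<union> h ` D)"
    by (rule card_Un_disjoint[symmetric]) (use fin disj in auto)
  also have "\<dots> \<le> card U"
    by (rule card_mono) (use g h assms(1) in auto)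
  finally show ?thesis .
qed

lemma language_take: "language X n = take n ` language X (Suc n)"
  by (simp add: language_def image_image take_word)

text \<open>Dropping the last letter is onto the shorter words, and a right special word has at
  least two preimages.\<close>

lemma card_right_special:
  assumes "finite (language X (Suc n))"
  shows "card (language X n) + card (right_special X n) \<le> card (language X (Suc n))"
  unfolding language_take[of X n]
proof (rule card_image_doubled[OF assms])
  show "right_special X n \<subseteq> take n ` language X (Suc n)"
    unfolding language_take[symmetric] by (auto simp: right_special_def language_def)
  fix d assume "d \<in> right_special X n"
  then obtain x y where xy: "x \<in> X" "y \<in> X" "d = word x 0 n" "d = word y 0 n" "y (int n) \<noteq> x (int n)"
    by (auto simp: right_special_def)
  then have "word x 0 (Suc n) \<noteq> word y 0 (Suc n)" by (simp add: word_def)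
  with xy show "\<exists>u\<in>language X (Suc n). \<exists>v\<in>language X (Suc n). u \<noteq> v \<and> take n u = d \<and> take n v = d"
    unfolding language_def by (intro bexI[of _ "word x 0 (Suc n)"] bexI[of _ "word y 0 (Suc n)"]) (auto simp: take_word)
qed

abbreviation "orbit_words x n \<equiv> range (\<lambda>t. word x t n)"

text \<open>If no word of length \<open>n\<close> of \<open>x\<close> is right special, then a word occurring infinitely often to the
  left determines all of \<open>x\<close>, which is then periodic.\<close>

lemma morse_hedlund:
  assumes np: "\<not> periodic x" and fin: "finite A" "\<And>t. x t \<in> A"
  shows "finite (orbit_words x n) \<and> n < card (orbit_words x n)"
proof (induction n)
  case 0
  show ?case by (simp add: word_def)
next
  case (Suc n)
  have finl: "finite (orbit_words x m)" for m
  proof (rule finite_subset)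
    show "orbit_words x m \<subseteq> {l. set l \<subseteq> A \<and> length l = m}" using fin(2) by (auto simp: word_def)
    show "finite {l. set l \<subseteq> A \<and> length l = m}" using finite_lists_length_eq[OF fin(1)] .
  qed
  have im: "orbit_words x n = take n ` orbit_words x (Suc n)"
    by (simp add: image_image take_word)
  \<comment> \<open>Equality would make \<open>take n\<close> injective: each word of length
    \<open>n\<close> would force the next letter, hence everything to its right.\<close>
  have "card (orbit_words x n) \<noteq> card (orbit_words x (Suc n))"
  proof
    assume "card (orbit_words x n) = card (orbit_words x (Suc n))"
    then have inj: "inj_on (take n) (orbit_words x (Suc n))"
      using im finl by (metis eq_card_imp_inj_on)
    have det1: "word x (s + 1) n = word x (t + 1) n \<and> x (s + int n) = x (t + int n)" if "word x s n = word x t n" for s t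
    proof -
      have "word x s (Suc n) = word x t (Suc n)"
        using inj_onD[OF inj, of "word x s (Suc n)" "word x t (Suc n)"] that by (simp add: take_word)
      then have "drop 1 (word x s (Suc n)) = drop 1 (word x t (Suc n))" "word x s (Suc n) ! n = word x t (Suc n) ! n"
        by simp_all
      then show ?thesis by (simp only: drop_word) simp
    qed
    have det: "word x (s + int j) n = word x (t + int j) n \<and> x (s + int n + int j) = x (t + int n + int j)"
      if "word x s n = word x t n" for s t j
    proof (induction j)
      case 0
      show ?case using that det1[OF that] by simp
    next
      case (Suc j)
      then have "word x (s + int j + 1) n = word x (t + int j + 1) n" using det1 by blast
      from this det1[OF this] show ?case by (simp add: algebra_simps)
    qed
    have det': "x (s + u) = x (t + u)" if "word x s n = word x t n" "u \<ge> int n" for s t u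
      using det[OF that(1), of "nat (u - int n)"] that(2) by simp
    have inf: "infinite {..<0::int}" by (rule infinite_Iio)
    have "finite ((\<lambda>t. word x t n) ` {..<0})" by (rule finite_subset[OF _ finl[of n]]) auto
    from pigeonhole_infinite[OF inf this] obtain a where a: "infinite {t\<in>{..<0}. word x t n = word x a n}" by auto
    define I where "I = {t\<in>{..<0}. word x t n = word x a n}"
    have I: "infinite I" "I \<subseteq> {..<0}" "\<And>s t. s \<in> I \<Longrightarrow> t \<in> I \<Longrightarrow> word x s n = word x t n"
      using a by (auto simp: I_def)
    obtain b where b: "b \<in> I" using I(1) by (metis ex_in_conv finite.emptyI)
    obtain c where c: "c \<in> I" "c \<noteq> b" using infinite_imp_nonempty[OF infinite_remove[OF I(1), of b]] by blast
    have "x (v + (b - c)) = x v" for v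
    proof -
      \<comment> \<open>From an occurrence \<open>s\<close> far to the left, \<open>x\<close>
        repeats both what follows \<open>b\<close> and what follows \<open>c\<close>; near
        \<open>v\<close> this turns \<open>b - c\<close> into a period.\<close>
      have "\<exists>s\<in>I. s \<le> v - \<bar>b - c\<bar> - int n"
      proof (rule ccontr)
        assume "\<not> ?thesis"
        then have "I \<subseteq> {v - \<bar>b - c\<bar> - int n..0}" using I(2) by force
        with I(1) show False using finite_subset by blast
      qed
      then obtain s where s: "s \<in> I" "s \<le> v - \<bar>b - c\<bar> - int n" by blast
      have ws: "word x s n = word x c n" "word x b n = word x c n" using I(3) s(1) b c(1) by blast+
      have "x (s + (v - s)) = x (c + (v - s))" by (rule det'[OF ws(1)]) (use s in auto)
      moreover have "x (c + (b - c + (v - s))) = x (s + (b - c + (v - s)))"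
        by (rule det'[OF ws(1)[symmetric]]) (use s in auto)
      moreover have "x (b + (v - s)) = x (c + (v - s))"
        by (rule det'[OF ws(2)]) (use s in auto)
      ultimately show ?thesis by (simp add: algebra_simps)
    qed
    then have "sh (b - c) x = sh 0 x" by (auto simp: sh_def)
    with np c show False using sh_eq_imp_periodic by (metis eq_iff_diff_eq_0)
  qed
  moreover have "card (orbit_words x n) \<le> card (orbit_words x (Suc n))"
    using im finl by (metis card_image_le)
  ultimately show ?case using Suc finl[of "Suc n"] by auto
qed

definition occurs_in :: "'a list \<Rightarrow> 'a list \<Rightarrow> bool" where
  "occurs_in w v \<longleftrightarrow> (\<exists>j. j + length w \<le> length v \<and> take (length w) (drop j v) = w)"

lemma occurs_in_word:
  "occurs_in w (word x t n) \<longleftrightarrow> (\<exists>j. j + length w \<le> n \<and> word x (t + int j) (length w) = w)"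
proof -
  have "take (length w) (drop j (word x t n)) = word x (t + int j) (length w)" if "j + length w \<le> n" for j
    using that by (simp add: drop_word take_word)
  then show ?thesis unfolding occurs_in_def by auto
qed

text \<open>Either every word of length \<open>n\<close> of \<open>x\<close> contains \<open>w\<close>, or there is an occurrence of \<open>w\<close> next to a
  gap; the windows around that occurrence are told apart by its offset.\<close>

lemma card_words_containing:
  assumes np: "\<not> periodic x" and fin: "finite A" "\<And>t. x t \<in> A"
    and w: "word x a (length w) = w" and n: "length w \<le> n"
  shows "n - length w < card {v \<in> orbit_words x n. occurs_in w v}"
proof -
  let ?W = "{v \<in> orbit_words x n. occurs_in w v}"
  let ?occ = "\<lambda>t. word x t (length w) = w"
  have finW: "finite ?W" using morse_hedlund[OF np fin, of n] by simp
  have offset: "n - length w < card ?W"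
    if occ: "?occ t" and P: "\<And>j j'. j \<le> n - length w \<Longrightarrow> j' \<le> n - length w \<Longrightarrow> j < j' \<Longrightarrow> word x (t - int j) n \<noteq> word x (t - int j') n" for t
  proof -
    have "inj_on (\<lambda>j. word x (t - int j) n) {..n - length w}"
      by (rule inj_onI) (metis P atMost_iff linorder_neqE_nat)
    moreover have "(\<lambda>j. word x (t - int j) n) ` {..n - length w} \<subseteq> ?W"
    proof safe
      fix j assume j: "j \<le> n - length w"
      show "occurs_in w (word x (t - int j) n)"
        unfolding occurs_in_word by (rule exI[of _ j]) (use j n occ in auto)
    qed auto
    ultimately have "card {..n - length w} \<le> card ?W" by (rule card_inj_on_le) (rule finW)
    then show ?thesis by simp
  qed
  show ?thesis
  proof (cases "\<forall>v\<in>orbit_words x n. occurs_in w v")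
    case True
    then have "?W = orbit_words x n" by auto
    with morse_hedlund[OF np fin, of n] show ?thesis
      by (metis diff_le_self le_less_trans)
  next
    case False
    then obtain b where "\<not> occurs_in w (word x b n)" by auto
    then have gap: "\<not> ?occ s" if "b \<le> s" "s \<le> b + int (n - length w)" for s
    proof -
      have "nat (s - b) + length w \<le> n" "b + int (nat (s - b)) = s" using that n by auto
      with \<open>\<not> occurs_in w (word x b n)\<close> show ?thesis unfolding occurs_in_word by metis
    qed
    have ws: "?occ (s + int j) \<longleftrightarrow> ?occ (s' + int j)" if "word x s n = word x s' n" "j \<le> n - length w" for s s' j
    proof -
      have "take (length w) (drop j (word x s n)) = take (length w) (drop j (word x s' n))" using that by simp
      moreover have "length w \<le> n - j" using that n by simp
      ultimately show ?thesis by (simp add: drop_word take_word)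
    qed
    \<comment> \<open>The gap starts at \<open>b\<close>. The occurrence at \<open>a\<close> lies on
      one side of it, and the occurrence nearest to the gap on that side is used.\<close>
    show ?thesis
    proof (cases "a < b")
      case True
      let ?S = "{s\<in>{a..b}. ?occ s}"
      have S: "finite ?S" "a \<in> ?S" using w True by (auto intro: finite_subset[of _ "{a..b}"])
      define t where "t = Max ?S"
      have t: "?occ t" "a \<le> t" "t \<le> b" using Max_in[OF S(1)] S(2) by (auto simp: t_def)
      have no: "\<not> ?occ s" if "t < s" "s \<le> b + int (n - length w)" for s
      proof (cases "s \<le> b")
        case True
        show ?thesis
        proof
          assume "?occ s"
          then have "s \<in> ?S" using True that t by auto
          then show False using Max_ge[OF S(1)] that by (fastforce simp: t_def)
        qed
      qed (use gap that in auto)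
      show ?thesis
      proof (rule offset[OF t(1)])
        fix j j' assume j: "j \<le> n - length w" "j' \<le> n - length w" "j < j'"
        \<comment> \<open>At offset \<open>j'\<close> one window shows \<open>w\<close>, while the
          other reads a position to the right of \<open>t\<close>, past the last occurrence.\<close>
        have "?occ (t - int j' + int j')" using t by simp
        moreover have "\<not> ?occ (t - int j + int j')" by (rule no) (use j t in auto)
        ultimately show "word x (t - int j) n \<noteq> word x (t - int j') n" using ws[OF _ j(2)] by blast
      qed
    next
      case False
      let ?S = "{s\<in>{b..a}. ?occ s}"
      have S: "finite ?S" "a \<in> ?S" using w False by (auto intro: finite_subset[of _ "{b..a}"])
      define t where "t = Min ?S"
      have t: "?occ t" "t \<le> a" "b \<le> t" using Min_in[OF S(1)] S(2) by (auto simp: t_def)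
      have tb: "t > b + int (n - length w)" using gap[of t] t by force
      have no: "\<not> ?occ s" if "s < t" "s \<ge> b" for s
      proof
        assume "?occ s"
        then have "s \<in> ?S" using that t by auto
        then show False using Min_le[OF S(1)] that by (fastforce simp: t_def)
      qed
      show ?thesis
      proof (rule offset[OF t(1)])
        fix j j' assume j: "j \<le> n - length w" "j' \<le> n - length w" "j < j'"
        have "?occ (t - int j + int j)" using t by simp
        moreover have "\<not> ?occ (t - int j' + int j)" by (rule no) (use j tb in auto)
        ultimately show "word x (t - int j) n \<noteq> word x (t - int j') n" using ws[OF _ j(1)] by blast
      qed
    qed
  qed
qed

text \<open>If \<open>z\<close> agreed with \<open>x\<close> on \<open>{a..<b}\<close> but not at \<open>b\<close>, then each \<open>\<phi> i z\<close> would leave \<open>\<phi> i x\<close> near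
  \<open>b\<close>, right after a right special word of length \<open>n\<close>. There are fewer than \<open>M\<close> of these, so two of
  the images of \<open>x\<close> would agree around \<open>0\<close> up to a small shift.\<close>

lemma extend_right:
  fixes \<phi> :: "nat \<Rightarrow> (int \<Rightarrow> 'a) \<Rightarrow> (int \<Rightarrow> 'a)"
  assumes inv: "\<And>x j. x \<in> X \<Longrightarrow> sh j x \<in> X"
    and fin: "finite (language X (Suc n))"
    and few: "card (language X (Suc n)) < card (language X n) + M"
    and \<phi>X: "\<And>i x. i < M \<Longrightarrow> x \<in> X \<Longrightarrow> \<phi> i x \<in> X"
    and code: "\<And>i. i < M \<Longrightarrow> block_code X r (\<phi> i)"
    and inv_code: "\<And>i x y t. \<lbrakk>i < M; x \<in> X; y \<in> X; \<forall>s\<in>{t - r..t + r}. \<phi> i x s = \<phi> i y s\<rbrakk> \<Longrightarrow> x t = y t"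
    and x: "x \<in> X" and z: "z \<in> X"
    and sep: "\<And>i j e. \<lbrakk>i < M; j < M; i \<noteq> j; e \<in> {-2*r..2*r}\<rbrakk> \<Longrightarrow> \<exists>u\<in>{-c..c}. \<phi> i x (u + e) \<noteq> \<phi> j x u"
    and ab: "b = a + int n + 2 * r" "a + 3 * r \<le> - c" "c + 3 * r < b" "r \<ge> 0"
    and agree: "\<forall>t\<in>{a..<b}. z t = x t"
  shows "z b = x b"
proof (rule ccontr)
  assume ne: "z b \<noteq> x b"
  \<comment> \<open>First disagreement of the two images: \<open>inv_code\<close> forces one within
    \<open>r\<close> of \<open>b\<close>, and \<open>code\<close> excludes any between
    \<open>a + r\<close> and \<open>b - r\<close>.\<close>
  have "\<exists>d\<in>{b - r..b + r}. \<phi> i z d \<noteq> \<phi> i x d \<and> (\<forall>t\<in>{a + r..<d}. \<phi> i z t = \<phi> i x t)" if i: "i < M" for i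
  proof -
    let ?D = "{d\<in>{b - r..b + r}. \<phi> i z d \<noteq> \<phi> i x d}"
    have "?D \<noteq> {}" using inv_code[OF i z x, of b] ne by blast
    moreover have "finite ?D" by (rule finite_subset[of _ "{b - r..b + r}"]) auto
    ultimately have m: "Min ?D \<in> ?D" "\<And>d. d \<in> ?D \<Longrightarrow> Min ?D \<le> d" using Min_in Min_le by blast+
    have "\<phi> i z t = \<phi> i x t" if t: "t \<in> {a + r..<Min ?D}" for t
    proof (cases "t < b - r")
      case True
      show ?thesis by (rule block_codeD[OF code[OF i] z x]) (use agree True t in auto)
    next
      case False
      show ?thesis
      proof (rule ccontr)
        assume "\<not> ?thesis"
        then have "t \<in> ?D" using False t m(1) by auto
        with m(2)[of t] t show False by simp
      qed
    qed
    moreover have "Min ?D \<in> {b - r..b + r}" "\<phi> i z (Min ?D) \<noteq> \<phi> i x (Min ?D)" using m(1) by blast+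
    ultimately show ?thesis by blast
  qed
  then obtain d where d: "\<And>i. i < M \<Longrightarrow> d i \<in> {b - r..b + r}" "\<And>i. i < M \<Longrightarrow> \<phi> i z (d i) \<noteq> \<phi> i x (d i)"
      "\<And>i t. i < M \<Longrightarrow> t \<in> {a + r..<d i} \<Longrightarrow> \<phi> i z t = \<phi> i x t" by metis
  \<comment> \<open>By \<open>b = a + int n + 2 * r\<close> this word starts at \<open>a + r\<close>
    or later, where the images of \<open>z\<close> and \<open>x\<close> agree.\<close>
  define v where "v i = word (\<phi> i x) (d i - int n) n" for i
  have v: "v i \<in> right_special X n" if i: "i < M" for i
  proof -
    let ?x = "sh (d i - int n) (\<phi> i x)" and ?z = "sh (d i - int n) (\<phi> i z)"
    have "?x \<in> X" "?z \<in> X" using inv \<phi>X x z i by blast+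
    moreover have "word ?z 0 n = word ?x 0 n"
      unfolding word_eq_iff using d(3)[OF i] d(1)[OF i] ab by auto
    moreover have "?z (int n) \<noteq> ?x (int n)" using d(2)[OF i] by simp
    moreover have "v i = word ?x 0 n" by (simp add: v_def)
    ultimately show ?thesis unfolding right_special_def by blast
  qed
  have "finite (right_special X n)"
  proof (rule finite_subset)
    show "right_special X n \<subseteq> language X n" by (auto simp: right_special_def language_def)
    show "finite (language X n)" unfolding language_take[of X n] using fin by simp
  qed
  moreover have "card (right_special X n) < card {..<M}"
    using card_right_special[OF fin] few by simp
  ultimately have "\<not> inj_on v {..<M}"
    using v by (meson card_inj_on_le image_subsetI lessThan_iff not_less)
  then obtain i j where ij: "i < M" "j < M" "i \<noteq> j" "v i = v j" by (auto simp: inj_on_def)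
  \<comment> \<open>Equal words align two images of \<open>x\<close> up to the offset
    \<open>d i - d j\<close>. As \<open>a + 3 * r \<le> - c\<close> and
    \<open>c + 3 * r < b\<close>, they cover the window on which \<open>sep\<close> finds a
    difference.\<close>
  have "d i - d j \<in> {-2*r..2*r}" using d(1)[OF ij(1)] d(1)[OF ij(2)] by auto
  from sep[OF ij(1-3) this] obtain u where u: "u \<in> {-c..c}" "\<phi> i x (u + (d i - d j)) \<noteq> \<phi> j x u" by blast
  have "u - (d j - int n) \<in> {0..<int n}" using u(1) d(1)[OF ij(2)] ab by auto
  with ij(4) have "\<phi> i x (d i - int n + (u - (d j - int n))) = \<phi> j x (d j - int n + (u - (d j - int n)))"
    unfolding v_def word_eq_iff by blast
  with u(2) show False by (simp add: algebra_simps)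
qed

section \<open>Reflection and extension to the left\<close>

definition reflect :: "(int \<Rightarrow> 'a) \<Rightarrow> (int \<Rightarrow> 'a)" where
  "reflect x = (\<lambda>t. x (- t))"

lemma reflect_apply [simp]: "reflect x t = x (- t)"
  by (simp add: reflect_def)

lemma reflect_reflect [simp]: "reflect (reflect x) = x"
  by (simp add: reflect_def)

lemma word_reflect: "word (reflect x) t n = rev (word x (1 - t - int n) n)"
  by (rule nth_equalityI) (auto simp: rev_nth of_nat_diff algebra_simps)

lemma language_reflect:
  assumes "\<And>x j. x \<in> X \<Longrightarrow> sh j x \<in> X"
  shows "language (reflect ` X) n = rev ` language X n"
proof -
  have "(\<lambda>x. word x (1 - int n) n) ` X = language X n"
  proof
    show "(\<lambda>x. word x (1 - int n) n) ` X \<subseteq> language X n"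
      using assms by (auto simp: language_def intro!: image_eqI[of _ _ "sh (1 - int n) _"])
    show "language X n \<subseteq> (\<lambda>x. word x (1 - int n) n) ` X"
      using assms by (auto simp: language_def intro!: image_eqI[of _ _ "sh (int n - 1) _"])
  qed
  then show ?thesis by (auto simp: language_def image_image word_reflect)
qed

lemma extend_left:
  fixes \<phi> :: "nat \<Rightarrow> (int \<Rightarrow> 'a) \<Rightarrow> (int \<Rightarrow> 'a)"
  assumes inv: "\<And>x j. x \<in> X \<Longrightarrow> sh j x \<in> X"
    and fin: "finite (language X (Suc n))"
    and few: "card (language X (Suc n)) < card (language X n) + M"
    and \<phi>X: "\<And>i x. i < M \<Longrightarrow> x \<in> X \<Longrightarrow> \<phi> i x \<in> X"
    and code: "\<And>i. i < M \<Longrightarrow> block_code X r (\<phi> i)"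
    and inv_code: "\<And>i x y t. \<lbrakk>i < M; x \<in> X; y \<in> X; \<forall>s\<in>{t - r..t + r}. \<phi> i x s = \<phi> i y s\<rbrakk> \<Longrightarrow> x t = y t"
    and x: "x \<in> X" and z: "z \<in> X"
    and sep: "\<And>i j e. \<lbrakk>i < M; j < M; i \<noteq> j; e \<in> {-2*r..2*r}\<rbrakk> \<Longrightarrow> \<exists>u\<in>{-c..c}. \<phi> i x (u + e) \<noteq> \<phi> j x u"
    and ab: "b = a + int n + 2 * r" "a + 3 * r \<le> - c" "c + 3 * r < b" "r \<ge> 0"
    and agree: "\<forall>t\<in>{a..<b}. z t = x t"
  shows "z (a - 1) = x (a - 1)"
proof -
  have neg: "- t \<in> {- s - r..- s + r} \<longleftrightarrow> t \<in> {s - r..s + r}" for s t by auto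
  \<comment> \<open>Negation turns \<open>{a..<b}\<close> into \<open>{1 - b..<1 - a}\<close>, so
    the letter just left of the window becomes the one at its excluded right end.\<close>
  have "reflect z (1 - a) = reflect x (1 - a)"
  proof (rule extend_right[where X = "reflect ` X" and n = n and M = M and r = r and c = c and a = "1 - b"
        and \<phi> = "\<lambda>i y. reflect (\<phi> i (reflect y))"])
    show "sh j y \<in> reflect ` X" if "y \<in> reflect ` X" for y j
    proof -
      from that obtain x where x: "x \<in> X" "y = reflect x" by blast
      then have "sh j y = reflect (sh (- j) x)" by (simp add: fun_eq_iff)
      with inv[OF x(1)] show ?thesis by blast
    qed
    have lr: "language (reflect ` X) m = rev ` language X m" for m
      by (rule language_reflect) (rule inv)
    have lang: "card (language (reflect ` X) m) = card (language X m)" for m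
      unfolding lr by (rule card_image) simp
    show "finite (language (reflect ` X) (Suc n))"
      using fin by (simp add: lr)
    show "card (language (reflect ` X) (Suc n)) < card (language (reflect ` X) n) + M"
      using few by (simp add: lang)
    show "reflect (\<phi> i (reflect y)) \<in> reflect ` X" if "i < M" "y \<in> reflect ` X" for i y
      using \<phi>X that by auto
    show "block_code (reflect ` X) r (\<lambda>y. reflect (\<phi> i (reflect y)))" if "i < M" for i
      unfolding block_code_def
    proof (intro ballI allI impI)
      fix y y' t assume y: "y \<in> reflect ` X" "y' \<in> reflect ` X" and ag: "\<forall>s\<in>{t - r..t + r}. y s = y' s"
      show "reflect (\<phi> i (reflect y)) t = reflect (\<phi> i (reflect y')) t"
        unfolding reflect_apply
        by (rule block_codeD[OF code[OF that]]) (use y ag in auto)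
    qed
    show "y t = y' t" if i: "i < M" and y: "y \<in> reflect ` X" "y' \<in> reflect ` X"
      and ag: "\<forall>s\<in>{t - r..t + r}. reflect (\<phi> i (reflect y)) s = reflect (\<phi> i (reflect y')) s" for i y y' t
    proof -
      have "reflect y (- t) = reflect y' (- t)"
      proof (rule inv_code[OF i])
        show "\<forall>s\<in>{- t - r..- t + r}. \<phi> i (reflect y) s = \<phi> i (reflect y') s"
        proof
          fix s assume "s \<in> {- t - r..- t + r}"
          then have "- s \<in> {t - r..t + r}" by auto
          with ag show "\<phi> i (reflect y) s = \<phi> i (reflect y') s" by fastforce
        qed
      qed (use y in auto)
      then show ?thesis by simp
    qed
    show "reflect x \<in> reflect ` X" "reflect z \<in> reflect ` X" using x z by auto
    show "\<exists>u\<in>{-c..c}. reflect (\<phi> i (reflect (reflect x))) (u + e) \<noteq> reflect (\<phi> j (reflect (reflect x))) u"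
      if ij: "i < M" "j < M" "i \<noteq> j" "e \<in> {-2*r..2*r}" for i j e
    proof -
      have "- e \<in> {-2*r..2*r}" using ij by auto
      from sep[OF ij(1-3) this] obtain u where "u \<in> {-c..c}" "\<phi> i x (u + - e) \<noteq> \<phi> j x u" by blast
      then show ?thesis by (intro bexI[of _ "- u"]) auto
    qed
    show "\<forall>t\<in>{1 - b..<1 - a}. reflect z t = reflect x t" using agree by auto
  qed (use ab in auto)
  then show ?thesis by simp
qed

section \<open>Consequences of linear complexity\<close>

locale linear_subshift = subshift +
  fixes k :: nat
  assumes linear_growth: "limsup (\<lambda>n. ereal (real (complexity A X n) / real n)) < ereal (real k)"
begin

lemma complexity_eq: "complexity A X n = card (language X n)"
proof -
  have "{w \<in> lists A. length w = n \<and> (\<exists>x\<in>X. \<forall>i<n. x (int i) = w ! i)} = language X n"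
  proof safe
    fix w x assume "x \<in> X" "\<forall>i<length w. x (int i) = w ! i"
    then show "w \<in> language X (length w)"
      unfolding language_def by (intro image_eqI[of _ _ x]) (auto simp: list_eq_iff_nth_eq)
  qed (auto simp: language_def word_def symbol_in)
  then show ?thesis by (simp add: complexity_def)
qed

lemma finite_language: "finite (language X n)"
proof (rule finite_subset)
  show "language X n \<subseteq> {l. set l \<subseteq> A \<and> length l = n}" using symbol_in by (auto simp: language_def word_def)
  show "finite {l. set l \<subseteq> A \<and> length l = n}" using finite_lists_length_eq[OF finite_alphabet] .
qed

text \<open>The constant strictly below \<open>k\<close> is what later yields \<open>m < k\<close>
  instead of \<open>m \<le> k\<close>.\<close>

lemma linear_bound:
  obtains c n0 where "c < real k" "\<And>n. n \<ge> n0 \<Longrightarrow> real (card (language X n)) \<le> c * real n"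
proof -
  from ereal_dense2[OF linear_growth] obtain c where c:
    "limsup (\<lambda>n. ereal (real (complexity A X n) / real n)) < ereal c" "ereal c < ereal (real k)" by blast
  from Limsup_lessD[OF c(1)] obtain n0 where n0: "\<And>n. n \<ge> n0 \<Longrightarrow> real (complexity A X n) / real n < c"
    by (auto simp: eventually_sequentially)
  show thesis
  \<comment> \<open>\<open>Suc n0\<close> excludes \<open>n = 0\<close>, where the quotient carries
    no information.\<close>
  proof (rule that[of c "Suc n0"])
    fix n assume "n \<ge> Suc n0"
    then show "real (card (language X n)) \<le> c * real n"
      using n0[of n] by (simp add: complexity_eq divide_simps)
  qed (use c in simp)
qed

text \<open>A single radius for each \<open>i\<close> provides a word of \<open>y i\<close> that no
  earlier point contains. The condition is one-sided because this is what appending points one at a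
  time preserves.\<close>

definition separated :: "nat \<Rightarrow> (nat \<Rightarrow> int \<Rightarrow> 'a) \<Rightarrow> bool" where
  "separated m y \<longleftrightarrow> (\<forall>i<m. y i \<in> X \<and> \<not> periodic (y i)) \<and>
     (\<forall>i<m. \<exists>N. \<forall>j<i. \<forall>s. \<exists>u\<in>{-N..N}. y j (s + u) \<noteq> y i u)"

text \<open>The words of length \<open>n\<close> of \<open>y i\<close> that contain its distinguishing window form disjoint families of
  about \<open>n\<close> words each.\<close>

lemma separated_less:
  assumes "separated m y"
  shows "m < k"
proof -
  from assms obtain N where N: "\<And>i j s. \<lbrakk>i < m; j < i\<rbrakk> \<Longrightarrow> \<exists>u\<in>{-N i..N i}. y j (s + u) \<noteq> y i u"
    unfolding separated_def by metis
  have yX: "y i \<in> X" "\<not> periodic (y i)" if "i < m" for i using assms that by (auto simp: separated_def)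
  \<comment> \<open>One radius for all \<open>i\<close>, so that the distinguishing words
    \<open>w i\<close> share the length \<open>L\<close>.\<close>
  define K where "K = nat (Max (insert 0 (N ` {..<m})))"
  have K: "N i \<le> int K" if "i < m" for i
    unfolding K_def using that Max_ge[of "insert 0 (N ` {..<m})" "N i"] by (simp add: le_nat_iff)
  define L where "L = 2 * K + 1"
  define w where "w i = word (y i) (- int K) L" for i
  define U where "U n i = {v \<in> orbit_words (y i) n. occurs_in (w i) v}" for n i
  have lw: "length (w i) = L" for i by (simp add: w_def)
  have bound: "m * (n - L) \<le> card (language X n)" if n: "n \<ge> L" for n
  proof -
    have cU: "n - L < card (U n i)" if "i < m" for i
      using card_words_containing[OF yX(2)[OF that] finite_alphabet, of "- int K" "w i" n] symbol_in[OF yX(1)[OF that]] n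
      by (simp add: lw U_def) (simp add: w_def)
    have finU: "finite (U n i)" if "i < m" for i using cU[OF that] by (metis card.infinite not_less_zero)
    have disj: "U n j \<inter> U n i = {}" if ij: "i < m" "j < i" for i j
    proof (rule ccontr)
      assume "U n j \<inter> U n i \<noteq> {}"
      then obtain t where "occurs_in (w i) (word (y j) t n)" by (auto simp: U_def)
      then obtain s where "word (y j) s L = w i" unfolding occurs_in_word lw by blast
      then have "\<forall>u\<in>{0..<int L}. y j (s + u) = y i (- int K + u)" by (simp add: w_def word_eq_iff)
      moreover obtain u where "u \<in> {-N i..N i}" "y j (s + int K + u) \<noteq> y i u" using N[OF ij, of "s + int K"] by blast
      moreover have "u + int K \<in> {0..<int L}" using calculation(2) K[OF ij(1)] by (auto simp: L_def)
      ultimately show False by (metis add.assoc add.commute add_minus_cancel)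
    qed
    have "m * (n - L) = (\<Sum>i<m. n - L)" by simp
    also have "\<dots> \<le> (\<Sum>i<m. card (U n i))" by (rule sum_mono) (use cU less_imp_le in auto)
    also have "\<dots> = card (\<Union>i<m. U n i)"
    proof (rule card_UN_disjoint[symmetric])
      show "\<forall>i\<in>{..<m}. \<forall>j\<in>{..<m}. i \<noteq> j \<longrightarrow> U n i \<inter> U n j = {}"
        using disj by (metis Int_commute lessThan_iff linorder_neqE_nat)
    qed (use finU in auto)
    also have "\<dots> \<le> card (language X n)"
    proof (rule card_mono[OF finite_language])
      show "(\<Union>i<m. U n i) \<subseteq> language X n"
      proof
        fix v assume "v \<in> (\<Union>i<m. U n i)"
        then obtain i t where "i < m" "v = word (y i) t n" by (auto simp: U_def)
        then show "v \<in> language X n" unfolding language_def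
          using yX(1) by (intro image_eqI[of _ _ "sh t (y i)"]) auto
      qed
    qed
    finally show ?thesis .
  qed
  obtain c n0 where c: "c < real k" "\<And>n. n \<ge> n0 \<Longrightarrow> real (card (language X n)) \<le> c * real n"
    using linear_bound by blast
  have "real m \<le> c"
  proof (rule ccontr)
    assume "\<not> real m \<le> c"
    then have pos: "real m - c > 0" by simp
    \<comment> \<open>Beyond \<open>n1\<close> the number \<open>n * (m - c)\<close> exceeds
      \<open>m * L\<close>, against \<open>m * (n - L) \<le> c * n\<close>.\<close>
    obtain n1 where n1: "real n1 > real m * real L / (real m - c)" using reals_Archimedean2 by blast
    define n where "n = max n1 (max n0 L)"
    have "real n \<ge> real n1" by (simp add: n_def)
    with n1 have "real m * real L / (real m - c) < real n" by linarith
    then have "real m * real L < real n * (real m - c)" using pos by (simp add: divide_simps)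
    moreover have "real m * (real n - real L) \<le> c * real n"
    proof -
      have nL: "n \<ge> L" by (simp add: n_def)
      have "real (m * (n - L)) \<le> real (card (language X n))" using bound[OF nL] by (simp only: of_nat_le_iff)
      also have "\<dots> \<le> c * real n" by (rule c) (simp add: n_def)
      finally show ?thesis using nL by (simp add: of_nat_diff)
    qed
    ultimately show False by (simp add: algebra_simps)
  qed
  with c(1) show ?thesis by simp
qed

text \<open>A separated family of maximal size: a point that its orbits fail to approximate could be
  appended to it.\<close>

lemma dense_family:
  obtains m y where "separated m y"
    "\<And>x N. \<lbrakk>x \<in> X; \<not> periodic x\<rbrakk> \<Longrightarrow> \<exists>j<m. \<exists>s. \<forall>u\<in>{-N..N}. x u = y j (s + u)"
proof -
  let ?P = "\<lambda>m. \<exists>y. separated m y"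
  have "?P 0" by (simp add: separated_def)
  have bd: "\<And>m. ?P m \<Longrightarrow> m \<le> k" using separated_less less_imp_le by blast
  define m where "m = Greatest ?P"
  have "?P m" unfolding m_def using GreatestI_nat[of ?P 0 k] bd \<open>?P 0\<close> by blast
  then obtain y where y: "separated m y" by blast
  show thesis
  proof (rule that[OF y])
    fix x N assume x: "x \<in> X" "\<not> periodic x"
    show "\<exists>j<m. \<exists>s. \<forall>u\<in>{-N..N}. x u = y j (s + u)"
    proof (rule ccontr)
      assume *: "\<not> ?thesis"
      let ?y = "y(m := x)"
      have "separated (Suc m) ?y"
        unfolding separated_def
      proof (intro conjI allI impI)
        fix i assume i: "i < Suc m"
        show "?y i \<in> X" "\<not> periodic (?y i)"
          using i x y by (auto simp: separated_def less_Suc_eq)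
        show "\<exists>N. \<forall>j<i. \<forall>s. \<exists>u\<in>{-N..N}. ?y j (s + u) \<noteq> ?y i u"
        proof (cases "i = m")
          case True
          have "\<forall>j<m. \<forall>s. \<exists>u\<in>{-N..N}. y j (s + u) \<noteq> x u" using * by metis
          with True show ?thesis by (intro exI[of _ N]) auto
        next
          case False
          with i have "i < m" by simp
          with y show ?thesis unfolding separated_def by (metis fun_upd_other order.strict_trans less_irrefl)
        qed
      qed
      then have "Suc m \<le> m" unfolding m_def using Greatest_le_nat[of ?P "Suc m" k] bd by (auto simp: m_def)
      then show False by simp
    qed
  qed
qed

text \<open>Larger increments throughout would add at least \<open>3 * k + 1\<close> words at each
  of \<open>Suc (n div 2)\<close> levels, while linear growth allows at most
  \<open>k * (n + Suc (n div 2))\<close>, which is at most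
  \<open>3 * k * Suc (n div 2)\<close>.\<close>

lemma good_level:
  obtains n0 where "\<And>n. n \<ge> n0 \<Longrightarrow> \<exists>m\<in>{n..n + n div 2}. card (language X (Suc m)) \<le> card (language X m) + 3 * k"
proof -
  obtain c n0 where c: "c < real k" "\<And>n. n \<ge> n0 \<Longrightarrow> real (card (language X n)) \<le> c * real n"
    using linear_bound by blast
  have le: "card (language X n) \<le> k * n" if "n \<ge> n0" for n
  proof -
    have "real (card (language X n)) \<le> real k * real n"
      using c(2)[OF that] mult_right_mono[OF less_imp_le[OF c(1)], of "real n"] by simp
    then show ?thesis by (metis of_nat_le_iff of_nat_mult)
  qed
  show thesis
  proof (rule that[of n0], rule ccontr)
    fix n assume n: "n \<ge> n0"
      and no: "\<not> (\<exists>m\<in>{n..n + n div 2}. card (language X (Suc m)) \<le> card (language X m) + 3 * k)"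
    have "card (language X (n + j)) \<ge> j * (3 * k + 1)" if "j \<le> Suc (n div 2)" for j
      using that
    proof (induction j)
      case (Suc j)
      have "\<not> card (language X (Suc (n + j))) \<le> card (language X (n + j)) + 3 * k" using no Suc.prems by auto
      with Suc show ?case by simp
    qed simp
    from this[of "Suc (n div 2)"] le[of "n + Suc (n div 2)"] n
    have "Suc (n div 2) * (3 * k + 1) \<le> k * (n + Suc (n div 2))" by simp
    also have "\<dots> \<le> k * (3 * Suc (n div 2))" by (rule mult_left_mono) auto
    also have "\<dots> < Suc (n div 2) * (3 * k + 1)" by (simp add: algebra_simps)
    finally show False by simp
  qed
qed

end

section \<open>Automorphism orbits of nonperiodic points\<close>

context subshift
begin

lemma uniform_range:
  assumes "finite \<Phi>" "\<Phi> \<subseteq> carrier aut"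
  obtains r where "r \<ge> 1" "\<And>f. f \<in> \<Phi> \<Longrightarrow> block_code X r f" "\<And>f. f \<in> \<Phi> \<Longrightarrow> block_code X r (inv\<^bsub>aut\<^esub> f)"
proof -
  have "\<exists>r\<ge>1. \<forall>f\<in>\<Phi>. block_code X r f \<and> block_code X r (inv\<^bsub>aut\<^esub> f)"
    using assms
  proof (induction \<Phi> rule: finite_induct)
    case (insert f \<Phi>)
    then obtain r where r: "r \<ge> 1" "\<forall>f\<in>\<Phi>. block_code X r f \<and> block_code X r (inv\<^bsub>aut\<^esub> f)" by auto
    from insert.prems have f: "f \<in> carrier aut" by simp
    then have "inv\<^bsub>aut\<^esub> f \<in> carrier aut" using group_aut by (simp add: group.inv_closed)
    with f obtain a b where "block_code X a f" "block_code X b (inv\<^bsub>aut\<^esub> f)"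
      using curtis_hedlund_lyndon by meson
    with r show ?case
      by (intro exI[of _ "max r (max a b)"]) (auto elim!: block_code_mono intro: block_code_mono)
  qed (auto intro: exI[of _ 1])
  with that show thesis by blast
qed

lemma aut_inv_code:
  assumes "f \<in> carrier aut" "block_code X r (inv\<^bsub>aut\<^esub> f)" "x \<in> X" "y \<in> X"
    "\<forall>s\<in>{t - r..t + r}. f x s = f y s"
  shows "x t = y t"
  using block_codeD[OF assms(2) aut_in[OF assms(1,3)] aut_in[OF assms(1,4)], of t] assms aut_inv_left
  by simp

end

context linear_subshift
begin

text \<open>At a level \<open>n\<close> where the complexity grows by at most \<open>3 * k\<close>, a central window of \<open>x\<close> of length
  about \<open>n\<close> determines the central window of length about \<open>2 * n\<close>. Such levels occur in every
  interval \<open>{n..n + n div 2}\<close>, so one central window determines \<open>x\<close>.\<close>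

lemma isolated_if_many_images:
  assumes \<phi>: "\<And>i. i \<le> 3 * k \<Longrightarrow> \<phi> i \<in> carrier aut" and x: "x \<in> X"
    and ne: "\<And>i j e. \<lbrakk>i \<le> 3 * k; j \<le> 3 * k; i \<noteq> j\<rbrakk> \<Longrightarrow> sh e (\<phi> i x) \<noteq> \<phi> j x"
  shows "\<exists>N. \<forall>z\<in>X. (\<forall>u\<in>{-N..N}. z u = x u) \<longrightarrow> z = x"
proof -
  let ?M = "3 * k + 1"
  obtain r where r: "r \<ge> 1" "\<And>i. i < ?M \<Longrightarrow> block_code X r (\<phi> i)" "\<And>i. i < ?M \<Longrightarrow> block_code X r (inv\<^bsub>aut\<^esub> (\<phi> i))"
  proof -
    have "\<phi> ` {..<?M} \<subseteq> carrier aut" using \<phi> by auto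
    from uniform_range[OF finite_imageI[OF finite_lessThan] this] obtain r where
      "r \<ge> 1" "\<And>f. f \<in> \<phi> ` {..<?M} \<Longrightarrow> block_code X r f" "\<And>f. f \<in> \<phi> ` {..<?M} \<Longrightarrow> block_code X r (inv\<^bsub>aut\<^esub> f)"
      by blast
    with that[of r] show thesis by blast
  qed
  \<comment> \<open>Offsets are bounded by \<open>2 * r\<close>, so there are finitely many
    comparisons and one radius \<open>c\<close> witnesses all of them.\<close>
  define I where "I = {(i, j, e). i < ?M \<and> j < ?M \<and> i \<noteq> j \<and> e \<in> {-2*r..2*r}}"
  have finI: "finite I" by (rule finite_subset[of _ "{..<?M} \<times> {..<?M} \<times> {-2*r..2*r}"]) (auto simp: I_def)
  have "\<exists>u. \<phi> i x (u + e) \<noteq> \<phi> j x u" if "(i, j, e) \<in> I" for i j e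
  proof (rule ccontr)
    assume "\<not> ?thesis"
    then have "sh e (\<phi> i x) = \<phi> j x" by (auto simp: sh_def)
    with ne that show False by (auto simp: I_def)
  qed
  then have "\<forall>p\<in>I. \<exists>u. \<phi> (fst p) x (u + snd (snd p)) \<noteq> \<phi> (fst (snd p)) x u" by auto
  then obtain g where g: "\<And>p. p \<in> I \<Longrightarrow> \<phi> (fst p) x (g p + snd (snd p)) \<noteq> \<phi> (fst (snd p)) x (g p)" by metis
  define c where "c = Max (insert 0 ((\<lambda>p. \<bar>g p\<bar>) ` I))"
  have c0: "c \<ge> 0" unfolding c_def using finI by (intro Max_ge) auto
  have gc: "\<bar>g p\<bar> \<le> c" if "p \<in> I" for p unfolding c_def using finI that by (intro Max_ge) auto
  have sep: "\<exists>u\<in>{-c..c}. \<phi> i x (u + e) \<noteq> \<phi> j x u" if "i < ?M" "j < ?M" "i \<noteq> j" "e \<in> {-2*r..2*r}" for i j e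
  proof -
    have I: "(i, j, e) \<in> I" using that by (simp add: I_def)
    have "g (i, j, e) \<in> {-c..c}" using gc[OF I] by auto
    with g[OF I] show ?thesis by auto
  qed
  \<comment> \<open>With \<open>a \<le> - C\<close> and \<open>b \<ge> C\<close> the window meets
    the position requirements of \<open>extend_right\<close> and \<open>extend_left\<close>.\<close>
  define C where "C = c + 3 * r + 1"
  have right: "z b = x b" and left: "z (a - 1) = x (a - 1)"
    if "z \<in> X" "card (language X (Suc n)) \<le> card (language X n) + 3 * k"
      "b = a + int n + 2 * r" "a \<le> - C" "b \<ge> C" "\<forall>t\<in>{a..<b}. z t = x t" for z n a b
  proof -
    have inv: "sh j y \<in> X" if "y \<in> X" for y j using that by simp
    have few: "card (language X (Suc n)) < card (language X n) + ?M" using that by simp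
    have \<phi>': "\<phi> i \<in> carrier aut" if "i < ?M" for i using \<phi> that by simp
    have \<phi>X: "\<phi> i y \<in> X" if "i < ?M" "y \<in> X" for i y using aut_in \<phi>' that by blast
    have ic: "y t = y' t" if "i < ?M" "y \<in> X" "y' \<in> X" "\<forall>s\<in>{t - r..t + r}. \<phi> i y s = \<phi> i y' s" for i y y' t
      by (rule aut_inv_code[OF \<phi>'[OF that(1)] r(3)[OF that(1)] that(2-4)])
    show "z b = x b"
      by (rule extend_right[where X = X and n = n and M = ?M and r = r and \<phi> = \<phi> and x = x and c = c and b = b];
          (fact inv finite_language few \<phi>X r(2) ic x that(1) sep that(3) | use that r(1) in \<open>auto simp: C_def\<close>))
    show "z (a - 1) = x (a - 1)"
      by (rule extend_left[where X = X and n = n and M = ?M and r = r and \<phi> = \<phi> and x = x and c = c and b = b];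
          (fact inv finite_language few \<phi>X r(2) ic x that(1) sep that(3) | use that r(1) in \<open>auto simp: C_def\<close>))
  qed
  have grow: "\<forall>t\<in>{- (int n + 2 * r - C)..int n + 2 * r - C}. z t = x t"
    if z: "z \<in> X" and good: "card (language X (Suc n)) \<le> card (language X n) + 3 * k"
      and K: "K \<ge> C" "2 * K \<ge> int n + 2 * r" and ag: "\<forall>t\<in>{-K..K}. z t = x t" for z n K
  proof -
    let ?N = "int n + 2 * r"
    \<comment> \<open>A window of length \<open>?N\<close> slides to the right as long as its left
      end stays at most \<open>- C\<close>, that is, until its right end reaches
      \<open>?N - C\<close>.\<close>
    have R: "\<forall>t\<in>{-K..K + int j}. z t = x t" if "K + int j \<le> max K (?N - C)" for j
      using that
    proof (induction j)
      case (Suc j)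
      then have IH: "\<forall>t\<in>{-K..K + int j}. z t = x t" by simp
      let ?b = "K + int j + 1"
      have "z ?b = x ?b"
        by (rule right[OF z good, of _ "?b - ?N"]) (use Suc.prems K IH in auto)
      with IH show ?case by (auto simp: algebra_simps) (smt (verit) atLeastAtMost_iff)
    qed (use ag in simp)
    have L: "\<forall>t\<in>{-K - int j..K}. z t = x t" if "K + int j \<le> max K (?N - C)" for j
      using that
    proof (induction j)
      case (Suc j)
      then have IH: "\<forall>t\<in>{-K - int j..K}. z t = x t" by simp
      let ?a = "- K - int j"
      have "z (?a - 1) = x (?a - 1)"
        by (rule left[OF z good, of "?a + ?N"]) (use Suc.prems K IH in auto)
      with IH show ?case by (auto simp: algebra_simps) (smt (verit) atLeastAtMost_iff)
    qed (use ag in simp)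
    let ?j = "nat (max K (?N - C) - K)"
    have j: "K + int ?j = max K (?N - C)" by simp
    show ?thesis
    proof
      fix t assume t: "t \<in> {- (?N - C)..?N - C}"
      show "z t = x t"
      proof (cases "t \<ge> 0")
        case True
        then have "t \<in> {-K..K + int ?j}" using t j K(1) c0 r(1) by (auto simp: C_def)
        with R[of ?j] j show ?thesis by simp
      next
        case False
        then have "t \<in> {-K - int ?j..K}" using t j K(1) c0 r(1) by (auto simp: C_def)
        with L[of ?j] j show ?thesis by simp
      qed
    qed
  qed
  obtain n0 where n0: "\<And>n. n \<ge> n0 \<Longrightarrow> \<exists>m\<in>{n..n + n div 2}. card (language X (Suc m)) \<le> card (language X m) + 3 * k"
    using good_level by blast
  define N0 where "N0 = int n0 + 10 * C"
  have step: "\<forall>t\<in>{- (K + 1)..K + 1}. z t = x t"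
    if z: "z \<in> X" and K: "K \<ge> N0" and ag: "\<forall>t\<in>{-K..K}. z t = x t" for z K
  proof -
    \<comment> \<open>A level \<open>m \<ge> ?n\<close> gives agreement up to radius
      \<open>m + 2 * r - C \<ge> K + 1\<close>. Being at most half as large again as
      \<open>?n\<close>, it satisfies \<open>m + 2 * r \<le> 2 * K\<close>; the margin
      \<open>10 * C\<close> in \<open>N0\<close> ensures this.\<close>
    let ?n = "nat (K + C + 1 - 2 * r)"
    have "?n \<ge> n0" using K c0 r(1) by (auto simp: N0_def C_def)
    from n0[OF this] obtain m where m: "m \<in> {?n..?n + ?n div 2}" "card (language X (Suc m)) \<le> card (language X m) + 3 * k"
      by blast
    have m1: "int m \<ge> K + C + 1 - 2 * r" using m(1) by auto
    have "2 * int m \<le> 3 * int ?n" using m(1) by auto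
    then have m2: "2 * int m \<le> 3 * (K + C + 1 - 2 * r)" using K c0 r(1) by (auto simp: N0_def C_def)
    have "\<forall>t\<in>{- (int m + 2 * r - C)..int m + 2 * r - C}. z t = x t"
      by (rule grow[OF z m(2) _ _ ag]) (use K c0 r(1) m2 in \<open>auto simp: N0_def C_def\<close>)
    with m1 show ?thesis by auto
  qed
  show ?thesis
  proof (intro exI[of _ N0] ballI impI)
    fix z assume z: "z \<in> X" and ag: "\<forall>u\<in>{-N0..N0}. z u = x u"
    have all: "\<forall>t\<in>{- (N0 + int j)..N0 + int j}. z t = x t" for j
    proof (induction j)
      case (Suc j)
      from step[OF z _ Suc] show ?case by (simp add: algebra_simps)
    qed (use ag in simp)
    show "z = x"
    proof
      fix t
      have "t \<in> {- (N0 + int (nat \<bar>t\<bar>))..N0 + int (nat \<bar>t\<bar>)}"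
        using c0 r(1) by (auto simp: N0_def C_def)
      with all show "z t = x t" by blast
    qed
  qed
qed

text \<open>An isolated point lies in the orbit closure of no point outside its orbit, so the images of an
  isolated nonperiodic point in distinct orbits are separated.\<close>

lemma finite_aut_orbit:
  assumes x: "x \<in> X" "\<not> periodic x"
  shows "finite ((\<lambda>f. range (\<lambda>j. sh j (f x))) ` carrier aut)"
proof (rule ccontr)
  let ?O = "\<lambda>f. range (\<lambda>j. sh j (f x))"
  assume "infinite (?O ` carrier aut)"
  from infinite_arbitrarily_large[OF this, of "3 * k + 1"]
  obtain B where B: "finite B" "card B = 3 * k + 1" "B \<subseteq> ?O ` carrier aut" by blast
  from ex_bij_betw_nat_finite[OF B(1)] obtain h where h: "bij_betw h {0..<3 * k + 1} B" using B(2) by auto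
  have "\<exists>f\<in>carrier aut. ?O f = h i" if "i \<le> 3 * k" for i
  proof -
    have "h i \<in> B" using h that by (auto simp: bij_betw_def)
    with B(3) have "h i \<in> ?O ` carrier aut" by (rule subsetD)
    then show ?thesis by (rule imageE) metis
  qed
  then obtain \<phi> where \<phi>: "\<And>i. i \<le> 3 * k \<Longrightarrow> \<phi> i \<in> carrier aut" "\<And>i. i \<le> 3 * k \<Longrightarrow> ?O (\<phi> i) = h i" by metis
  have ne: "sh e (\<phi> i x) \<noteq> \<phi> j x" if ij: "i \<le> 3 * k" "j \<le> 3 * k" "i \<noteq> j" for i j e
  proof
    assume eq: "sh e (\<phi> i x) = \<phi> j x"
    have "?O (\<phi> j) = ?O (\<phi> i)"
    proof
      show "?O (\<phi> j) \<subseteq> ?O (\<phi> i)" using eq by (metis (no_types, lifting) image_subsetI rangeI sh_sh)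
      have "\<phi> i x = sh (- e) (\<phi> j x)" using eq[symmetric] by simp
      then show "?O (\<phi> i) \<subseteq> ?O (\<phi> j)" by (metis (no_types, lifting) image_subsetI rangeI sh_sh)
    qed
    then have "h i = h j" using \<phi>(2) ij by simp
    with h ij show False by (auto simp: bij_betw_def inj_on_def)
  qed
  from isolated_if_many_images[of \<phi> x] \<phi>(1) x(1) ne
  obtain N where N: "\<And>z. \<lbrakk>z \<in> X; \<forall>u\<in>{-N..N}. z u = x u\<rbrakk> \<Longrightarrow> z = x" by blast
  have "separated (3 * k + 1) (\<lambda>i. \<phi> i x)"
    unfolding separated_def
  proof (intro conjI allI impI)
    fix i assume i: "i < 3 * k + 1"
    then have f: "\<phi> i \<in> carrier aut" using \<phi>(1) by simp
    show "\<phi> i x \<in> X" using aut_in[OF f x(1)] .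
    show "\<not> periodic (\<phi> i x)" using x(2) aut_periodic_iff[OF f x(1)] by (simp add: periodic_def)
    obtain r where r: "block_code X r (inv\<^bsub>aut\<^esub> (\<phi> i))"
      using curtis_hedlund_lyndon group.inv_closed[OF group_aut f] by blast
    show "\<exists>N. \<forall>j<i. \<forall>s. \<exists>u\<in>{-N..N}. \<phi> j x (s + u) \<noteq> \<phi> i x u"
    \<comment> \<open>The inverse of \<open>\<phi> i\<close> has range \<open>r\<close>, so
      agreement with \<open>\<phi> i x\<close> to radius \<open>N + r\<close> pulls back to
      agreement with \<open>x\<close> to radius \<open>N\<close>, where \<open>x\<close> is
      isolated.\<close>
    proof (intro exI[of _ "N + r"] allI impI, rule ccontr)
      fix j s assume j: "j < i" and "\<not> (\<exists>u\<in>{- (N + r)..N + r}. \<phi> j x (s + u) \<noteq> \<phi> i x u)"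
      then have ag: "\<And>u. u \<in> {- (N + r)..N + r} \<Longrightarrow> sh s (\<phi> j x) u = \<phi> i x u" by (simp add: add.commute)
      have fj: "\<phi> j \<in> carrier aut" using \<phi>(1) i j by simp
      let ?y = "sh s (\<phi> j x)" and ?z = "(inv\<^bsub>aut\<^esub> (\<phi> i)) (sh s (\<phi> j x))"
      have y: "?y \<in> X" using aut_in[OF fj x(1)] by simp
      have z: "?z \<in> X" using aut_in[OF group.inv_closed[OF group_aut f] y] .
      have "?z = x"
      proof (rule N[OF z], intro ballI)
        fix u assume u: "u \<in> {-N..N}"
        have "?z u = (inv\<^bsub>aut\<^esub> (\<phi> i)) (\<phi> i x) u"
          by (rule block_codeD[OF r y aut_in[OF f x(1)]]) (rule ag, use u in auto)
        then show "?z u = x u" using aut_inv_left[OF f x(1)] by simp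
      qed
      then have "\<phi> i x = ?y" using aut_inv_right[OF f y] by simp
      with ne[of j i s] i j show False by simp
    qed
  qed
  from separated_less[OF this] show False by simp
qed

end

section \<open>Automorphisms that fix the nonperiodic points\<close>

lemma finite_periodic_orbit:
  assumes "periodic x"
  shows "finite (range (\<lambda>j. sh j x))"
proof -
  from assms obtain p where p: "p > 0" "sh p x = x" by (auto simp: periodic_def)
  have "range (\<lambda>j. sh j x) \<subseteq> (\<lambda>j. sh j x) ` {0..<p}"
  proof safe
    fix j
    have "sh j x = sh (j mod p) (sh (j div p * p) x)" by simp
    also have "\<dots> = sh (j mod p) x" using sh_mult[OF p(2)] by simp
    finally show "sh j x \<in> (\<lambda>j. sh j x) ` {0..<p}" using p(1) by (intro image_eqI[of _ _ "j mod p"]) auto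
  qed
  then show ?thesis by (rule finite_subset) simp
qed

text \<open>The factor \<open>\<Prod>{1..R}\<close> is there so that a point not fixed by
  \<open>sh p\<close> cannot have a period in \<open>{1..R}\<close>.\<close>

lemma common_period:
  assumes "finite F" "\<And>x. x \<in> F \<Longrightarrow> periodic x"
  obtains p where "p > 0" "\<And>x. x \<in> F \<Longrightarrow> sh p x = x" "\<And>q. 0 < q \<Longrightarrow> q \<le> R \<Longrightarrow> (q::int) dvd p"
proof -
  have "\<exists>p>0. \<forall>x\<in>F. sh p x = x"
    using assms
  proof (induction F rule: finite_induct)
    case (insert x F)
    from insert.IH[OF insert.prems[OF insertI2]] obtain p where p: "p > 0" "\<forall>y\<in>F. sh p y = y" by blast
    obtain q where q: "q > 0" "sh q x = x" using insert.prems by (auto simp: periodic_def)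
    show ?case
    proof (intro exI[of _ "p * q"] conjI ballI)
      fix y assume "y \<in> insert x F"
      then show "sh (p * q) y = y"
        using sh_mult[OF q(2), of p] sh_mult[of p y q] p(2) by (auto simp: mult.commute)
    qed (use p q in simp)
  qed (auto intro: exI[of _ 1])
  then obtain p where p: "p > 0" "\<And>x. x \<in> F \<Longrightarrow> sh p x = x" by blast
  show thesis
  proof (rule that[of "\<Prod>{1..R} * p"])
    show "\<Prod>{1..R} * p > 0" using p(1) by (intro mult_pos_pos prod_pos) auto
    show "sh (\<Prod>{1..R} * p) x = x" if "x \<in> F" for x using sh_mult[OF p(2)[OF that]] .
    show "q dvd \<Prod>{1..R} * p" if "0 < q" "q \<le> R" for q
      using dvd_prodI[of "{1..R}" q "\<lambda>q. q"] that by (intro dvd_mult2) auto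
  qed
qed

context subshift
begin

lemma finite_period: assumes "p > 0" shows "finite {x \<in> X. sh p x = x}"
proof (rule finite_imageD)
  let ?f = "\<lambda>x. restrict x {0..<p}"
  show "finite (?f ` {x \<in> X. sh p x = x})"
  proof (rule finite_subset)
    show "?f ` {x \<in> X. sh p x = x} \<subseteq> {0..<p} \<rightarrow>\<^sub>E A" using symbol_in by auto
    show "finite ({0..<p} \<rightarrow>\<^sub>E A)" by (rule finite_PiE) (use finite_alphabet in auto)
  qed
  show "inj_on ?f {x \<in> X. sh p x = x}"
  proof (rule inj_onI, safe)
    fix x y :: "int \<Rightarrow> 'a" assume xy: "sh p x = x" "sh p y = y" "?f x = ?f y"
    show "x = y"
    proof
      fix t
      have *: "z t = z (t mod p)" if "sh p z = z" for z :: "int \<Rightarrow> 'a"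
        using fun_cong[OF sh_mult[OF that, of "t div p"], of "t mod p"] by simp
      have "t mod p \<in> {0..<p}" using assms by simp
      then have "x (t mod p) = y (t mod p)" using fun_cong[OF xy(3), of "t mod p"] by simp
      then show "x t = y t" using *[OF xy(1)] *[OF xy(2)] by simp
    qed
  qed
qed

text \<open>An infinite set of periodic points violating a local condition accumulates at a periodic point
  \<open>y\<close>. Recentring its members where they first leave \<open>y\<close> gives in the limit a nonperiodic point,
  asymptotic to the orbit of \<open>y\<close>, that violates the condition as well.\<close>

lemma finite_local_exceptions:
  assumes local: "\<And>x y. (\<forall>u\<in>{-n..n}. x u = y u) \<Longrightarrow> Q x \<longleftrightarrow> Q y"
    and Q: "\<And>x. \<lbrakk>x \<in> X; \<not> periodic x\<rbrakk> \<Longrightarrow> Q x" and n: "n \<ge> 0"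
  shows "finite {x \<in> X. \<exists>t. \<not> Q (sh t x)}"
proof -
  have per: "periodic x" if "x \<in> X" "\<not> Q (sh t x)" for x t
    using Q[of "sh t x"] that by auto
  have "finite {x \<in> X. \<not> Q x}"
  proof (rule ccontr)
    assume "infinite {x \<in> X. \<not> Q x}"
    then obtain f :: "nat \<Rightarrow> _" where f: "inj f" "range f \<subseteq> {x \<in> X. \<not> Q x}"
      using infinite_countable_subset by blast
    then have fX: "f i \<in> X" "\<not> Q (f i)" for i by auto
    from cluster_point[of f] fX(1) obtain y where y: "y \<in> X" "\<And>N. infinite {i. \<forall>t\<in>{-N..N}. f i t = y t}" by blast
    have "\<not> Q y"
    proof -
      obtain i where "\<forall>t\<in>{-n..n}. f i t = y t" using infinite_imp_nonempty[OF y(2)[of n]] by blast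
      from local[OF this] fX(2) show ?thesis by blast
    qed
    then have "periodic y" using per[of y 0] y(1) by simp
    then obtain p where p: "p > 0" "sh p y = y" by (auto simp: periodic_def)
    have py: "y (t - p) = y t" for t using fun_cong[OF p(2), of "t - p"] by simp
    define K where "K = p + 2 * n + 2"
    have "\<exists>z \<tau>. z \<in> X \<and> (\<forall>t\<in>{-int M..<0}. z t = y (\<tau> + t)) \<and> z 0 \<noteq> y \<tau>" for M
    proof -
      have "{i. \<forall>t\<in>{-int M..int M}. f i t = y t} - {i. f i = y} \<noteq> {}"
      proof
        assume "{i. \<forall>t\<in>{-int M..int M}. f i t = y t} - {i. f i = y} = {}"
        then have "{i. \<forall>t\<in>{-int M..int M}. f i t = y t} \<subseteq> {i. f i = y}" by blast
        moreover have "finite {i. f i = y}"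
          using finite_vimageI[OF _ f(1), of "{y}"] by (simp add: vimage_def)
        ultimately show False using y(2)[of "int M"] finite_subset by blast
      qed
      then obtain i where i: "\<forall>t\<in>{-int M..int M}. f i t = y t" "f i \<noteq> y" by blast
      have pf: "periodic (f i)" using per[of "f i" 0] fX[of i] by simp
      \<comment> \<open>Periodic points that agree on a right half-line coincide, so a disagreement
        exists to the right of 0.\<close>
      have "\<exists>t::nat. f i (int t) \<noteq> y (int t)"
      proof (rule ccontr)
        assume "\<not> ?thesis"
        then have "f i t = y t" if "t \<ge> 0" for t using that by (metis nonneg_int_cases)
        from periodic_eqI_right[OF pf \<open>periodic y\<close> this] i(2) show False by blast
      qed
      define \<tau> where "\<tau> = (LEAST t::nat. f i (int t) \<noteq> y (int t))"
      have \<tau>: "f i (int \<tau>) \<noteq> y (int \<tau>)" unfolding \<tau>_def using LeastI_ex[OF \<open>\<exists>t::nat. f i (int t) \<noteq> y (int t)\<close>] .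
      have \<tau>': "f i (int t) = y (int t)" if "t < \<tau>" for t using not_less_Least that unfolding \<tau>_def by blast
      have "f i (int \<tau> + t) = y (int \<tau> + t)" if t: "t \<in> {-int M..<0}" for t
      proof (cases "int \<tau> + t \<ge> 0")
        case True
        then have "int \<tau> + t = int (nat (int \<tau> + t))" "nat (int \<tau> + t) < \<tau>" using t by auto
        then show ?thesis using \<tau>' by metis
      next
        case False
        then show ?thesis using i(1) t by auto
      qed
      then show ?thesis
        using \<tau> fX(1)[of i] by (intro exI[of _ "sh (int \<tau>) (f i)"] exI[of _ "int \<tau>"]) (auto simp: add.commute)
    qed
    then obtain z \<tau> where z: "\<And>M. z M \<in> X" "\<And>M t. t \<in> {-int M..<0} \<Longrightarrow> z M t = y (\<tau> M + t)" "\<And>M. z M 0 \<noteq> y (\<tau> M)"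
      by metis
    from cluster_point[of z] z(1) obtain x where x: "x \<in> X" "\<And>N. infinite {i. \<forall>t\<in>{-N..N}. z i t = x t}" by blast
    have ex: "\<exists>M. int M \<ge> N \<and> (\<forall>t\<in>{-N..N}. z M t = x t)" for N
    proof -
      obtain M where "M \<ge> nat N" "\<forall>t\<in>{-N..N}. z M t = x t"
        using x(2)[of N] unfolding infinite_nat_iff_unbounded_le by blast
      then show ?thesis by (intro exI[of _ M]) auto
    qed
    have left: "x (t - p) = x t" if "t < 0" for t
    proof -
      obtain M where M: "int M \<ge> p - t" "\<forall>s\<in>{-(p - t)..p - t}. z M s = x s" using ex by blast
      have "x (t - p) = z M (t - p)" "x t = z M t" using M(2) p(1) that by auto
      moreover have "z M (t - p) = y (\<tau> M + t - p)" "z M t = y (\<tau> M + t)"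
        using z(2)[of "t - p" M] z(2)[of t M] that M(1) p(1) by (auto simp: algebra_simps)
      ultimately show ?thesis using py by simp
    qed
    obtain M where M: "int M \<ge> K" "\<forall>t\<in>{-K..K}. z M t = x t" using ex by blast
    have K: "K \<ge> p" "K \<ge> 0" using p(1) n by (auto simp: K_def)
    \<comment> \<open>The period \<open>p\<close> that \<open>x\<close> has to the left of 0 breaks
      at 0, where \<open>z M\<close> leaves the orbit of \<open>y\<close>.\<close>
    have jump: "x 0 \<noteq> x (- p)"
    proof -
      have "x 0 = z M 0" "x (- p) = z M (- p)" using M(2) K p(1) by auto
      moreover have "z M (- p) = y (\<tau> M - p)" using z(2)[of "- p" M] M(1) K p(1) by simp
      ultimately show ?thesis using z(3)[of M] py by simp
    qed
    \<comment> \<open>Moving by a multiple of a period would carry the jump into the left half-line,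
      where none exists.\<close>
    have "\<not> periodic x"
    proof
      assume "periodic x"
      then obtain q where q: "q > 0" "sh q x = x" by (auto simp: periodic_def)
      have qx: "x (t - p * q) = x t" for t using fun_cong[OF sh_mult[OF q(2), of p], of "t - p * q"] by simp
      have "p * q > 0" using p(1) q(1) by simp
      then have "x (- (p * q) - p) = x (- (p * q))" using left by simp
      moreover have "- (p * q) - p = - p - p * q" by simp
      ultimately show False using jump qx[of 0] qx[of "- p"] by simp
    qed
    \<comment> \<open>Chosen to make \<open>\<tau> M + s\<close> a multiple of \<open>p\<close> with
      the window of radius \<open>n\<close> around \<open>s\<close> left of 0, so that this window
      shows \<open>y\<close> around 0. It stays within \<open>K = p + 2 * n + 2\<close>.\<close>
    define s where "s = - n - 1 - (\<tau> M - n - 1) mod p"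
    have s: "s \<le> - n - 1" "s > - n - 1 - p" using pos_mod_bound[OF p(1), of "\<tau> M - n - 1"] pos_mod_sign[OF p(1), of "\<tau> M - n - 1"]
      by (simp_all add: s_def)
    have "Q (sh s x) \<longleftrightarrow> Q y"
    proof (rule local, intro ballI)
      fix u assume u: "u \<in> {-n..n}"
      have "sh s x u = z M (u + s)" using M(2) u s n by (auto simp: K_def)
      also have "\<dots> = y (\<tau> M + (u + s))" using z(2)[of "u + s" M] u s M(1) by (auto simp: K_def)
      also have "\<tau> M + (u + s) = u + (\<tau> M - n - 1) div p * p"
        using div_mult_mod_eq[of "\<tau> M - n - 1" p] unfolding s_def by linarith
      also have "y (u + (\<tau> M - n - 1) div p * p) = y u"
        using fun_cong[OF sh_mult[OF p(2), of "(\<tau> M - n - 1) div p"], of u] by simp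
      finally show "sh s x u = y u" .
    qed
    with \<open>\<not> Q y\<close> \<open>\<not> periodic x\<close> Q[of "sh s x"] x(1) show False by simp
  qed
  then have "finite (\<Union>x\<in>{x \<in> X. \<not> Q x}. range (\<lambda>j. sh j x))"
    using finite_periodic_orbit per[of _ 0] by auto
  moreover have "{x \<in> X. \<exists>t. \<not> Q (sh t x)} \<subseteq> (\<Union>x\<in>{x \<in> X. \<not> Q x}. range (\<lambda>j. sh j x))"
  proof safe
    fix x t assume "x \<in> X" "\<not> Q (sh t x)"
    then show "x \<in> (\<Union>x\<in>{x \<in> X. \<not> Q x}. range (\<lambda>j. sh j x))"
      by (intro UN_I[of "sh t x"]) (auto intro!: image_eqI[of _ _ "- t"])
  qed
  ultimately show ?thesis by (rule finite_subset[rotated])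
qed

end

text \<open>The windows where a displacement can be ambiguous: if moving a word by two different
  amounts of size at most \<open>r\<close> has the same effect, the word has a period of at most
  \<open>2 * r\<close>. Hence \<open>R\<close> becomes \<open>2 * r\<close>.\<close>

definition window_periodic :: "int \<Rightarrow> int \<Rightarrow> (int \<Rightarrow> 'a) \<Rightarrow> int \<Rightarrow> bool" where
  "window_periodic R d x a \<longleftrightarrow>
     (\<exists>q\<in>{1..R}. \<forall>w. - d \<le> w \<and> w + q \<le> d \<longrightarrow> x (a + w) = x (a + w + q))"

lemma window_periodicE:
  assumes "window_periodic R d x a"
  obtains q where "1 \<le> q" "q \<le> R" "\<And>s. \<lbrakk>a - d \<le> s - q; s \<le> a + d\<rbrakk> \<Longrightarrow> x (s - q) = x s"
proof -
  from assms obtain q where q: "q \<in> {1..R}" "\<And>w. - d \<le> w \<Longrightarrow> w + q \<le> d \<Longrightarrow> x (a + w) = x (a + w + q)"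
    unfolding window_periodic_def by blast
  have "x (s - q) = x s" if "a - d \<le> s - q" "s \<le> a + d" for s
    using q(2)[of "s - q - a"] that by simp
  with q(1) that show thesis by auto
qed

text \<open>Both facts below extend an identity to the right one letter at a time. If the last letter is
  predicted by a period \<open>q\<close> and by a period \<open>q'\<close> of the preceding window, then going back by \<open>q + q'\<close>
  shows that the predictions agree.\<close>

lemma window_periodic_imp_period:
  assumes per: "periodic x" and d: "R \<le> d" and win: "\<And>a. window_periodic R d x a"
  shows "\<exists>q\<in>{1..R}. sh q x = x"
proof -
  from window_periodicE[OF win[of 0]] obtain q where q: "1 \<le> q" "q \<le> R"
    "\<And>s. \<lbrakk>- d \<le> s - q; s \<le> d\<rbrakk> \<Longrightarrow> x (s - q) = x s" by auto
  have *: "\<forall>s\<in>{q - d..d + int j}. x (s - q) = x s" for j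
  proof (induction j)
    case (Suc j)
    let ?z = "d + int j + 1"
    from window_periodicE[OF win[of "?z - d"]] obtain q' where q': "1 \<le> q'" "q' \<le> R"
      "\<And>s. \<lbrakk>?z - d - d \<le> s - q'; s \<le> ?z - d + d\<rbrakk> \<Longrightarrow> x (s - q') = x s" by blast
    have "x ?z = x (?z - q')" using q'(3)[of ?z] q' d by simp
    also have "\<dots> = x (?z - q' - q)" using Suc q q'(1,2) d by auto
    also have "\<dots> = x (?z - q)" using q'(3)[of "?z - q"] q q'(2) d by (simp add: algebra_simps)
    finally have "x (?z - q) = x ?z" by simp
    moreover have "s = ?z \<or> s \<in> {q - d..d + int j}" if "s \<in> {q - d..d + int (Suc j)}" for s using that by auto
    ultimately show ?case using Suc by blast
  qed (use q(3) in auto)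
  have "x (t + q) = x t" if "t \<ge> - d" for t
  proof -
    have "t + q \<in> {q - d..d + int (nat (t + q - d))}" using that by auto
    then have "x (t + q - q) = x (t + q)" using * by blast
    then show ?thesis by simp
  qed
  from sh_eq_of_right_period[where a = "- d", OF per this] q(1,2) show ?thesis by auto
qed

lemma eq_if_agree_on_nonperiodic_windows:
  assumes per: "periodic x" "periodic y" and d: "R \<le> d" "R \<ge> 1"
    and agree: "\<And>a u. \<not> window_periodic R d x a \<or> \<not> window_periodic R d y a \<Longrightarrow> u \<in> {a - d..a + d} \<Longrightarrow> x u = y u"
    and np: "\<And>q. q \<in> {1..R} \<Longrightarrow> sh q x \<noteq> x"
  shows "x = y"
proof -
  \<comment> \<open>The extension starts from a window where agreement is given outright;
    \<open>x\<close> has one because it has no small period.\<close>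
  obtain a where a: "\<not> window_periodic R d x a"
    using window_periodic_imp_period[OF per(1) d(1)] np by blast
  have *: "\<forall>u\<in>{a - d..a + d + int j}. x u = y u" for j
  proof (induction j)
    case 0
    show ?case using agree[of a] a by auto
  next
    case (Suc j)
    let ?z = "a + d + int j + 1"
    have "x ?z = y ?z"
    proof (cases "window_periodic R d x (?z - d) \<and> window_periodic R d y (?z - d)")
      case False
      then show ?thesis using agree[of "?z - d" ?z] d by auto
    next
      case True
      from window_periodicE[OF conjunct1[OF True]] obtain q where q: "1 \<le> q" "q \<le> R"
        "\<And>s. \<lbrakk>?z - d - d \<le> s - q; s \<le> ?z - d + d\<rbrakk> \<Longrightarrow> x (s - q) = x s" by blast
      from window_periodicE[OF conjunct2[OF True]] obtain q' where q': "1 \<le> q'" "q' \<le> R"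
        "\<And>s. \<lbrakk>?z - d - d \<le> s - q'; s \<le> ?z - d + d\<rbrakk> \<Longrightarrow> y (s - q') = y s" by blast
      have "x ?z = x (?z - q)" using q(3)[of ?z] q d by simp
      also have "\<dots> = y (?z - q)" using Suc q d by auto
      also have "\<dots> = y (?z - q - q')" using q'(3)[of "?z - q"] q q' d by simp
      also have "\<dots> = x (?z - q - q')" using Suc q q' d by auto
      also have "?z - q - q' = ?z - q' - q" by simp
      also have "x (?z - q' - q) = x (?z - q')" using q(3)[of "?z - q'"] q q' d by simp
      also have "\<dots> = y (?z - q')" using Suc q' d by auto
      also have "\<dots> = y ?z" using q'(3)[of ?z] q' d by simp
      finally show ?thesis .
    qed
    moreover have "s = ?z \<or> s \<in> {a - d..a + d + int j}" if "s \<in> {a - d..a + d + int (Suc j)}" for s using that by auto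
    ultimately show ?case using Suc by blast
  qed
  have "x t = y t" if "t \<ge> a - d" for t
  proof -
    have "t \<in> {a - d..a + d + int (nat (t - a - d))}" using that by auto
    then show ?thesis using * by blast
  qed
  from periodic_eqI_right[where a = "a - d", OF per this] show ?thesis .
qed

section \<open>Rigid motion of windows\<close>

context subshift
begin

text \<open>Induction invariant for products of generators. A moved window may match another
  \<open>y i'\<close> than before; \<open>E\<close>, later equality of displacements under all
  generators, ensures that the next factor still moves it by the amount expected from
  \<open>i\<close>.\<close>

definition moves_rigidly ::
    "nat \<Rightarrow> (nat \<Rightarrow> int \<Rightarrow> 'a) \<Rightarrow> (nat \<Rightarrow> nat \<Rightarrow> bool) \<Rightarrow> (int \<Rightarrow> 'a) set \<Rightarrow> int \<Rightarrow> int \<Rightarrow> int \<Rightarrow>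
      ((int \<Rightarrow> 'a) \<Rightarrow> (int \<Rightarrow> 'a)) \<Rightarrow> (nat \<Rightarrow> int) \<Rightarrow> bool" where
  "moves_rigidly m y E Z R d n h K \<longleftrightarrow>
    (\<forall>i<m. h (y i) = sh (K i) (y i)) \<and> (\<forall>x\<in>Z. h x \<in> Z) \<and>
    (\<forall>i<m. \<forall>i'<m. E i i' \<longrightarrow> K i = K i') \<and>
    (\<forall>x\<in>Z. \<forall>a i s. i < m \<longrightarrow> (\<forall>u\<in>{-n..n}. x (a + u) = y i (s + u)) \<longrightarrow> \<not> window_periodic R d x a \<longrightarrow>
      (\<exists>i'<m. \<exists>s'. (\<forall>u\<in>{-n..n}. h x (a - K i + u) = y i' (s' + u)) \<and> E i i') \<and>
      (\<forall>u\<in>{-d..d}. h x (a - K i + u) = x (a + u)))"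

lemma moves_rigidlyD:
  assumes "moves_rigidly m y E Z R d n h K"
  shows "i < m \<Longrightarrow> h (y i) = sh (K i) (y i)"
    and "x \<in> Z \<Longrightarrow> h x \<in> Z"
    and "\<lbrakk>i < m; i' < m; E i i'\<rbrakk> \<Longrightarrow> K i = K i'"
    and "\<lbrakk>x \<in> Z; i < m; \<forall>u\<in>{-n..n}. x (a + u) = y i (s + u); \<not> window_periodic R d x a\<rbrakk> \<Longrightarrow>
      \<exists>i'<m. \<exists>s'. (\<forall>u\<in>{-n..n}. h x (a - K i + u) = y i' (s' + u)) \<and> E i i'"
    and "\<lbrakk>x \<in> Z; i < m; \<forall>u\<in>{-n..n}. x (a + u) = y i (s + u); \<not> window_periodic R d x a\<rbrakk> \<Longrightarrow>
      \<forall>u\<in>{-d..d}. h x (a - K i + u) = x (a + u)"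
proof -
  note a = assms[unfolded moves_rigidly_def]
  show "i < m \<Longrightarrow> h (y i) = sh (K i) (y i)" using conjunct1[OF a] by blast
  show "x \<in> Z \<Longrightarrow> h x \<in> Z" using conjunct1[OF conjunct2[OF a]] by blast
  show "\<lbrakk>i < m; i' < m; E i i'\<rbrakk> \<Longrightarrow> K i = K i'" using conjunct1[OF conjunct2[OF conjunct2[OF a]]] by blast
  note b = conjunct2[OF conjunct2[OF conjunct2[OF a]], THEN bspec, THEN spec, THEN spec, THEN spec, THEN mp, THEN mp, THEN mp]
  assume c: "x \<in> Z" "i < m" "\<forall>u\<in>{-n..n}. x (a + u) = y i (s + u)" "\<not> window_periodic R d x a"
  show "\<exists>i'<m. \<exists>s'. (\<forall>u\<in>{-n..n}. h x (a - K i + u) = y i' (s' + u)) \<and> E i i'"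
    using b[OF c] by (rule conjunct1)
  show "\<forall>u\<in>{-d..d}. h x (a - K i + u) = x (a + u)" using b[OF c] by (rule conjunct2)
qed

text \<open>On points that everywhere look like some \<open>y i\<close>, a product of generators moves a window that is
  not locally periodic rigidly, by the displacement of any matching \<open>y i\<close>: two points \<open>y i\<close> and
  \<open>y i'\<close> sharing such a window are displaced equally by each generator.\<close>

lemma rigid_motion:
  fixes m :: nat
  assumes T: "T \<subseteq> carrier aut" "\<And>g. g \<in> T \<Longrightarrow> inv\<^bsub>aut\<^esub> g \<in> T"
    and r: "r \<ge> 1" "\<And>g. g \<in> T \<Longrightarrow> block_code X r g"
    and y: "\<And>i. i < m \<Longrightarrow> y i \<in> X"
    and J: "\<And>g i. \<lbrakk>g \<in> T; i < m\<rbrakk> \<Longrightarrow> g (y i) = sh (J g i) (y i)" "\<And>g i. \<lbrakk>g \<in> T; i < m\<rbrakk> \<Longrightarrow> \<bar>J g i\<bar> \<le> r"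
    and d: "d \<ge> 2 * r" and n: "n = d + 4 * r"
    and Z: "\<And>x. x \<in> Z \<Longrightarrow> x \<in> X" "\<And>g x. \<lbrakk>g \<in> T; x \<in> Z\<rbrakk> \<Longrightarrow> g x \<in> Z"
    and near: "\<And>x a. x \<in> Z \<Longrightarrow> \<exists>i<m. \<exists>s. \<forall>u\<in>{-n..n}. x (a + u) = y i (s + u)"
    and h: "h \<in> generate aut T"
  shows "\<exists>K. moves_rigidly m y (\<lambda>i i'. \<forall>g\<in>T. J g i = J g i') Z (2 * r) d n h K"
    (is "\<exists>K. ?P h K")
proof -
  have gen: "?P g (J g)" if g: "g \<in> T" for g
    unfolding moves_rigidly_def
  proof (intro conjI allI impI ballI)
    fix i assume "i < m"
    then show "g (y i) = sh (J g i) (y i)" using J(1) g by blast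
  next
    fix x assume "x \<in> Z" then show "g x \<in> Z" using Z(2) g by blast
  next
    fix i i' assume "\<forall>g\<in>T. J g i = J g i'" then show "J g i = J g i'" using g by blast
  next
    fix x a i s assume x: "x \<in> Z" and i: "i < m" and match: "\<forall>u\<in>{-n..n}. x (a + u) = y i (s + u)"
      and np: "\<not> window_periodic (2 * r) d x a"
    have d0: "d \<ge> 0" using d r(1) by simp
    \<comment> \<open>\<open>g\<close> sees only a part of \<open>x\<close> that matches a shift of
      \<open>y i\<close>, so it acts as on \<open>y i\<close>. Range and displacement together cost
      \<open>2 * r\<close> of the radius.\<close>
    have move: "g x (a - J g i + u) = y i (s + u)" if u: "u \<in> {- (n - 2 * r)..n - 2 * r}" for u
    proof -
      have Jr: "\<bar>J g i\<bar> \<le> r" using J(2)[OF g i] .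
      have "g x (a - J g i + u) = g (sh (s - a) (y i)) (a - J g i + u)"
      proof (rule block_codeD[OF r(2)[OF g] Z(1)[OF x]])
        fix v assume v: "a - J g i + u - r \<le> v" "v \<le> a - J g i + u + r"
        have "v - a \<in> {-n..n}" using v u Jr by auto
        with match have "x (a + (v - a)) = y i (s + (v - a))" by blast
        then show "x v = sh (s - a) (y i) v" by (simp add: algebra_simps)
      qed (use y i in simp)
      also have "\<dots> = sh (s - a) (sh (J g i) (y i)) (a - J g i + u)"
        using aut_sh[of g "y i" "s - a"] T(1) g y[OF i] J(1)[OF g i] by auto
      also have "\<dots> = y i (s + u)" by (simp add: algebra_simps)
      finally show ?thesis .
    qed
    show "\<exists>i'<m. \<exists>s'. (\<forall>u\<in>{-n..n}. g x (a - J g i + u) = y i' (s' + u)) \<and> (\<forall>g\<in>T. J g i = J g i')"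
    proof -
      from near[OF Z(2)[OF g x], of "a - J g i"] obtain i' s' where
        i': "i' < m" and match': "\<forall>u\<in>{-n..n}. g x (a - J g i + u) = y i' (s' + u)" by blast
      have common: "y i (s + u) = y i' (s' + u)" if "u \<in> {- (n - 2 * r)..n - 2 * r}" for u
        using move[OF that] match' that r(1) by auto
      have "J f i = J f i'" if f: "f \<in> T" for f
      proof (rule ccontr)
        assume ne: "J f i \<noteq> J f i'"
        have Jr: "\<bar>J f i\<bar> \<le> r" "\<bar>J f i'\<bar> \<le> r" using J(2) f i i' by auto
        have fC: "f \<in> carrier aut" using T(1) f by blast
        \<comment> \<open>Different displacements of the shared word make it locally periodic. Of
          the margin \<open>4 * r\<close> in \<open>n\<close>, \<open>2 * r\<close> went into
          \<open>common\<close>, \<open>r\<close> is the range of \<open>f\<close>, and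
          \<open>r\<close> allows for moving \<open>w\<close> by a displacement.\<close>
        have eq: "y i (s + u + J f i) = y i (s + u + J f i')" if u: "u \<in> {- (d + r)..d + r}" for u
        proof -
          have "f (y i) (s + u) = f (sh (s' - s) (y i')) (s + u)"
          proof (rule block_codeD[OF r(2)[OF f] y[OF i]])
            fix v assume v: "s + u - r \<le> v" "v \<le> s + u + r"
            have "v - s \<in> {- (n - 2 * r)..n - 2 * r}" using v u n by auto
            from common[OF this] show "y i v = sh (s' - s) (y i') v" by (simp add: algebra_simps)
          qed (use y i' in simp)
          also have "\<dots> = sh (s' - s) (sh (J f i') (y i')) (s + u)"
            using aut_sh[OF fC y[OF i'], of "s' - s"] J(1)[OF f i'] by simp
          also have "\<dots> = y i' (s' + (u + J f i'))" by (simp add: algebra_simps)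
          also have "\<dots> = y i (s + (u + J f i'))" by (rule common[symmetric]) (use u Jr n in auto)
          finally show ?thesis using J(1)[OF f i] by (simp add: algebra_simps)
        qed
        have "window_periodic (2 * r) d x a"
          unfolding window_periodic_def
        proof (intro bexI allI impI)
          let ?q = "\<bar>J f i' - J f i\<bar>"
          show "?q \<in> {1..2 * r}" using ne Jr by auto
          fix w assume w: "- d \<le> w \<and> w + ?q \<le> d"
          have "y i (s + w) = y i (s + w + ?q)"
          proof (cases "J f i < J f i'")
            case True
            have "w - J f i \<in> {- (d + r)..d + r}" using w Jr by auto
            from eq[OF this] True show ?thesis by (simp add: algebra_simps)
          next
            case False
            have "w - J f i' \<in> {- (d + r)..d + r}" using w Jr by auto
            from eq[OF this] False show ?thesis by (simp add: algebra_simps)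
          qed
          moreover have "w \<in> {-n..n}" "w + ?q \<in> {-n..n}" using w n r(1) by auto
          then have "x (a + w) = y i (s + w)" "x (a + (w + ?q)) = y i (s + (w + ?q))" using match by blast+
          ultimately show "x (a + w) = x (a + w + ?q)" by (simp add: add.assoc)
        qed
        with np show False by contradiction
      qed
      with i' match' show ?thesis by blast
    qed
    fix u assume "u \<in> {-d..d}"
    then show "g x (a - J g i + u) = x (a + u)"
      using move[of u] match n r(1) by auto
  qed
  show ?thesis
    using h
  proof (induction h rule: generate.induct)
    case one
    have "?P \<one>\<^bsub>aut\<^esub> (\<lambda>_. 0)"
      using y Z(1) by (auto simp: aut_one moves_rigidly_def)
    then show ?case by blast
  next
    case (incl g)
    then show ?case using gen by blast
  next
    case (inv g)
    then show ?case using gen T(2) by blast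
  next
    case (eng h1 h2)
    then obtain K1 K2 where "?P h1 K1" "?P h2 K2" by blast
    note K1 = moves_rigidlyD[OF this(1)] and K2 = moves_rigidlyD[OF this(2)]
    have C: "h1 \<in> carrier aut" "h2 \<in> carrier aut"
      using eng.hyps group.generate_in_carrier[OF group_aut T(1)] by blast+
    have "?P (h1 \<otimes>\<^bsub>aut\<^esub> h2) (\<lambda>i. K1 i + K2 i)"
      unfolding moves_rigidly_def
    proof (intro conjI allI impI ballI)
      fix i assume i: "i < m"
      have "h1 (h2 (y i)) = h1 (sh (K2 i) (y i))" using K2(1)[OF i] by (rule arg_cong)
      also have "\<dots> = sh (K2 i) (h1 (y i))" using aut_sh[OF C(1) y[OF i]] .
      also have "\<dots> = sh (K2 i) (sh (K1 i) (y i))" using K1(1)[OF i] by (rule arg_cong)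
      finally show "(h1 \<otimes>\<^bsub>aut\<^esub> h2) (y i) = sh (K1 i + K2 i) (y i)"
        using aut_mult[OF C y[OF i]] by (simp add: add.commute)
    next
      fix x assume x: "x \<in> Z"
      then show "(h1 \<otimes>\<^bsub>aut\<^esub> h2) x \<in> Z" using aut_mult[OF C Z(1)[OF x]] K1(2)[OF K2(2)[OF x]] by simp
    next
      fix i i' assume "i < m" "i' < m" "\<forall>g\<in>T. J g i = J g i'"
      then have "K1 i = K1 i'" "K2 i = K2 i'" using K1(3) K2(3) by blast+
      then show "K1 i + K2 i = K1 i' + K2 i'" by simp
    next
      fix x a i s assume x: "x \<in> Z" and i: "i < m" and match: "\<forall>u\<in>{-n..n}. x (a + u) = y i (s + u)"
        and np: "\<not> window_periodic (2 * r) d x a"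
      have hx: "h2 x \<in> Z" using K2(2)[OF x] .
      note ex2 = K2(4)[OF x i match np] and w2 = K2(5)[OF x i match np]
      from ex2 obtain i' s' where i': "i' < m" and match': "\<forall>u\<in>{-n..n}. h2 x (a - K2 i + u) = y i' (s' + u)"
        and J': "\<forall>g\<in>T. J g i = J g i'" by blast
      \<comment> \<open>\<open>h2\<close> moved the window without changing it, so it is still not
        locally periodic and the invariant of \<open>h1\<close> applies.\<close>
      have np': "\<not> window_periodic (2 * r) d (h2 x) (a - K2 i)"
      proof
        assume "window_periodic (2 * r) d (h2 x) (a - K2 i)"
        then obtain q where q: "q \<in> {1..2 * r}" "\<And>w. - d \<le> w \<Longrightarrow> w + q \<le> d \<Longrightarrow> h2 x (a - K2 i + w) = h2 x (a - K2 i + w + q)"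
          unfolding window_periodic_def by blast
        have "x (a + w) = x (a + w + q)" if w: "- d \<le> w" "w + q \<le> d" for w
        proof -
          have "w \<in> {-d..d}" "w + q \<in> {-d..d}" using w q(1) by auto
          with w2 have "h2 x (a - K2 i + w) = x (a + w)" "h2 x (a - K2 i + (w + q)) = x (a + (w + q))" by blast+
          with q(2)[OF w] show ?thesis by (simp add: add.assoc)
        qed
        with q(1) np show False unfolding window_periodic_def by blast
      qed
      have KK: "K1 i' = K1 i" using K1(3)[OF i i' J'] by simp
      note ex1 = K1(4)[OF hx i' match' np'] and w1 = K1(5)[OF hx i' match' np']
      have e: "a - (K1 i + K2 i) = a - K2 i - K1 i'" using KK by simp
      have m: "(h1 \<otimes>\<^bsub>aut\<^esub> h2) x = h1 (h2 x)" using aut_mult[OF C Z(1)[OF x]] .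
      show "\<exists>i'<m. \<exists>s'. (\<forall>u\<in>{-n..n}. (h1 \<otimes>\<^bsub>aut\<^esub> h2) x (a - (K1 i + K2 i) + u) = y i' (s' + u)) \<and> (\<forall>g\<in>T. J g i = J g i')"
        unfolding e m using ex1 J' by simp
      show "(h1 \<otimes>\<^bsub>aut\<^esub> h2) x (a - (K1 i + K2 i) + u) = x (a + u)" if "u \<in> {-d..d}" for u
        unfolding e m using w1 w2 that by simp
    qed
    then show ?case by blast
  qed
qed

text \<open>A nonzero displacement would make the fixed point \<open>y i\<close> periodic, so
  \<open>h\<close> leaves every window that is not locally periodic in place. Its inverse covers
  windows that fail to be locally periodic only in \<open>h x\<close>. The radius
  \<open>6 * r\<close> is \<open>d + 4 * r\<close> with \<open>d = 2 * r\<close>.\<close>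

lemma fixes_if_fixes_family:
  fixes m :: nat
  assumes T: "T \<subseteq> carrier aut" "\<And>g. g \<in> T \<Longrightarrow> inv\<^bsub>aut\<^esub> g \<in> T"
    and r: "r \<ge> 1" "\<And>g. g \<in> T \<Longrightarrow> block_code X r g"
    and y: "\<And>i. i < m \<Longrightarrow> y i \<in> X" "\<And>i. i < m \<Longrightarrow> \<not> periodic (y i)"
    and J: "\<And>g i. \<lbrakk>g \<in> T; i < m\<rbrakk> \<Longrightarrow> g (y i) = sh (J g i) (y i)" "\<And>g i. \<lbrakk>g \<in> T; i < m\<rbrakk> \<Longrightarrow> \<bar>J g i\<bar> \<le> r"
    and Z: "\<And>x. x \<in> Z \<Longrightarrow> x \<in> X" "\<And>g x. \<lbrakk>g \<in> T; x \<in> Z\<rbrakk> \<Longrightarrow> g x \<in> Z"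
    and near: "\<And>x a. x \<in> Z \<Longrightarrow> \<exists>i<m. \<exists>s. \<forall>u\<in>{-(6 * r)..6 * r}. x (a + u) = y i (s + u)"
    and h: "h \<in> generate aut T" and fix_y: "\<And>i. i < m \<Longrightarrow> h (y i) = y i"
    and x: "x \<in> Z" "periodic x" and np: "\<And>q. q \<in> {1..2 * r} \<Longrightarrow> sh q x \<noteq> x"
  shows "h x = x"
proof -
  have hC: "h \<in> carrier aut" using group.generate_in_carrier[OF group_aut T(1)] h by blast
  have xX: "x \<in> X" using Z(1) x(1) .
  have rigid: "g z \<in> Z \<and> (\<forall>a u. \<not> window_periodic (2 * r) (2 * r) z a \<longrightarrow> u \<in> {a - 2 * r..a + 2 * r} \<longrightarrow> g z u = z u)"
    if g: "g \<in> generate aut T" and fixg: "\<And>i. i < m \<Longrightarrow> g (y i) = y i" and z: "z \<in> Z" for g z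
  proof -
    have "\<exists>K. moves_rigidly m y (\<lambda>i i'. \<forall>g\<in>T. J g i = J g i') Z (2 * r) (2 * r) (6 * r) g K"
      by (rule rigid_motion; (fact T r y(1) J Z near g | simp))
    then obtain K where "moves_rigidly m y (\<lambda>i i'. \<forall>g\<in>T. J g i = J g i') Z (2 * r) (2 * r) (6 * r) g K" by blast
    note K = moves_rigidlyD[OF this]
    have K0: "K i = 0" if "i < m" for i
    proof (rule ccontr)
      assume "K i \<noteq> 0"
      moreover have "sh (K i) (y i) = sh 0 (y i)" using K(1)[OF that] fixg[OF that] by simp
      ultimately have "periodic (y i)" by (rule sh_eq_imp_periodic[rotated])
      with y(2)[OF that] show False by contradiction
    qed
    have "g z u = z u" if w: "\<not> window_periodic (2 * r) (2 * r) z a" and u: "u \<in> {a - 2 * r..a + 2 * r}" for a u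
    proof -
      obtain i s where i: "i < m" "\<forall>u\<in>{-(6 * r)..6 * r}. z (a + u) = y i (s + u)" using near[OF z] by blast
      have "u - a \<in> {-(2 * r)..2 * r}" using u by auto
      with K(5)[OF z i w] K0[OF i(1)] have "g z (a - 0 + (u - a)) = z (a + (u - a))" by metis
      then show ?thesis by simp
    qed
    with K(2)[OF z] show ?thesis by blast
  qed
  let ?h' = "inv\<^bsub>aut\<^esub> h"
  have h': "?h' \<in> generate aut T" using group.generate_m_inv_closed[OF group_aut T(1) h] .
  have fix_y': "?h' (y i) = y i" if "i < m" for i using aut_inv_left[OF hC y(1)[OF that]] fix_y[OF that] by simp
  have hx: "h x \<in> Z" using rigid[OF h fix_y x(1)] by blast
  have "x = h x"
  proof (rule eq_if_agree_on_nonperiodic_windows[of _ _ "2 * r" "2 * r"])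
    show "periodic (h x)" using x(2) aut_periodic_iff[OF hC xX] by (auto simp: periodic_def)
    fix a u assume w: "\<not> window_periodic (2 * r) (2 * r) x a \<or> \<not> window_periodic (2 * r) (2 * r) (h x) a"
      and u: "u \<in> {a - 2 * r..a + 2 * r}"
    from w show "x u = h x u"
    proof
      assume "\<not> window_periodic (2 * r) (2 * r) x a"
      with rigid[OF h fix_y x(1)] u show ?thesis by metis
    next
      assume "\<not> window_periodic (2 * r) (2 * r) (h x) a"
      with rigid[OF h' fix_y' hx] u have "?h' (h x) u = h x u" by blast
      then show ?thesis using aut_inv_left[OF hC xX] by simp
    qed
  qed (use x r(1) np in auto)
  then show ?thesis by simp
qed

end

section \<open>Subgroups of finite index and of integer lattices\<close>

lemma int_multiple_closed:
  fixes M :: "(nat \<Rightarrow> int) set"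
  assumes zero: "(\<lambda>_. 0) \<in> M" and diff: "\<And>v w. v \<in> M \<Longrightarrow> w \<in> M \<Longrightarrow> (\<lambda>t. v t - w t) \<in> M"
    and b: "b \<in> M"
  shows "(\<lambda>t. q * b t) \<in> M"
proof -
  have neg: "(\<lambda>t. - v t) \<in> M" if "v \<in> M" for v using diff[OF zero that] by simp
  have nat: "(\<lambda>t. int n * b t) \<in> M" for n
  proof (induction n)
    case (Suc n)
    from diff[OF Suc neg[OF b]] show ?case by (simp add: algebra_simps)
  qed (use zero in simp)
  show ?thesis
  proof (cases q rule: int_cases2)
    case (nonneg n)
    then show ?thesis using nat by simp
  next
    case (nonpos n)
    then show ?thesis using neg[OF nat[of n]] by simp
  qed
qed

text \<open>The values of the last coordinate on \<open>M\<close> are the multiples of some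
  \<open>c\<close>. Unless \<open>c\<close> is 0, an element \<open>e\<close> attaining the least
  positive value is adjoined to a basis of the kernel \<open>N\<close> of that coordinate.\<close>

lemma int_subgroup_basis:
  fixes M :: "(nat \<Rightarrow> int) set"
  assumes zero: "(\<lambda>_. 0) \<in> M" and diff: "\<And>v w. v \<in> M \<Longrightarrow> w \<in> M \<Longrightarrow> (\<lambda>t. v t - w t) \<in> M"
    and supp: "\<And>v i. v \<in> M \<Longrightarrow> i \<ge> m \<Longrightarrow> v i = 0"
  shows "\<exists>d\<le>m. \<exists>b. range (\<lambda>w t. \<Sum>i<d. w i * b i t) = M \<and>
    (\<forall>w. (\<forall>t. (\<Sum>i<d. w i * b i t) = 0) \<longrightarrow> (\<forall>i<d. w i = (0::int)))"
  using assms
proof (induction m arbitrary: M)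
  case 0
  then have "M = {\<lambda>_. 0}" by fastforce
  then show ?case by (intro exI[of _ 0]) auto
next
  case (Suc m)
  note zero = Suc.prems(1) and diff = Suc.prems(2) and supp = Suc.prems(3)
  define N where "N = {v \<in> M. v m = 0}"
  have "\<exists>d\<le>m. \<exists>b. range (\<lambda>w t. \<Sum>i<d. w i * b i t) = N \<and>
    (\<forall>w. (\<forall>t. (\<Sum>i<d. w i * b i t) = 0) \<longrightarrow> (\<forall>i<d. w i = (0::int)))"
  proof (rule Suc.IH)
    show "v i = 0" if "v \<in> N" "i \<ge> m" for v i
      using that supp[of v i] by (cases "i = m") (auto simp: N_def)
  qed (use zero diff in \<open>auto simp: N_def\<close>)
  then obtain d b where d: "d \<le> m" and b: "range (\<lambda>w t. \<Sum>i<d. w i * b i t) = N"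
    and ind: "\<And>w. (\<forall>t. (\<Sum>i<d. w i * b i t) = 0) \<Longrightarrow> \<forall>i<d. w i = (0::int)" by blast
  show ?case
  proof (cases "N = M")
    case True
    with d b ind show ?thesis by (intro exI[of _ d] exI[of _ b]) auto
  next
    case False
    then obtain v where v: "v \<in> M" "v m \<noteq> 0" by (auto simp: N_def)
    let ?P = "\<lambda>n::nat. n > 0 \<and> (\<exists>v\<in>M. v m = int n)"
    have "?P (nat \<bar>v m\<bar>)"
    proof (cases "v m > 0")
      case False
      then show ?thesis using v diff[OF zero v(1)] by (auto intro!: bexI[of _ "\<lambda>t. 0 - v t"])
    qed (use v in auto)
    then have L: "?P (LEAST n. ?P n)" by (rule LeastI)
    define c where "c = int (LEAST n. ?P n)"
    from L obtain e where e: "e \<in> M" "e m = c" and c0: "c > 0" by (auto simp: c_def)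
    have red: "(\<lambda>t. v t - v m div c * e t) \<in> N" if v: "v \<in> M" for v
    proof -
      let ?w = "\<lambda>t. v t - v m div c * e t"
      have w: "?w \<in> M" by (rule diff[OF v int_multiple_closed[OF zero diff e(1)]])
      have wm: "?w m = v m mod c" using e(2) by (simp add: minus_div_mult_eq_mod)
      have "v m mod c = 0"
      proof (rule ccontr)
        assume ne: "v m mod c \<noteq> 0"
        have "v m mod c > 0" using ne pos_mod_sign[OF c0, of "v m"] by linarith
        then have "?P (nat (v m mod c))" using w wm by (intro conjI bexI[of _ ?w]) auto
        then have "(LEAST n. ?P n) \<le> nat (v m mod c)" by (rule Least_le)
        then show False using pos_mod_bound[OF c0, of "v m"] \<open>v m mod c > 0\<close> by (simp add: c_def)
      qed
      with w wm show ?thesis by (simp add: N_def)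
    qed
    let ?b = "b(d := e)"
    have split: "(\<Sum>i<Suc d. w i * ?b i t) = (\<Sum>i<d. w i * b i t) + w d * e t" for w t
      by simp
    have inN: "(\<lambda>t. \<Sum>i<d. w i * b i t) \<in> N" for w :: "nat \<Rightarrow> int"
      using b by blast
    show ?thesis
    proof (intro exI[of _ "Suc d"] exI[of _ ?b] conjI allI impI)
      show "Suc d \<le> Suc m" using d by simp
      show "range (\<lambda>w t. \<Sum>i<Suc d. w i * ?b i t) = M"
      proof
        show "range (\<lambda>w t. \<Sum>i<Suc d. w i * ?b i t) \<subseteq> M"
        proof safe
          fix w :: "nat \<Rightarrow> int"
          have "(\<lambda>t. (\<Sum>i<d. w i * b i t) - (- w d) * e t) \<in> M"
            by (rule diff[OF _ int_multiple_closed[OF zero diff e(1)]]) (use inN in \<open>simp add: N_def\<close>)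
          then show "(\<lambda>t. \<Sum>i<Suc d. w i * ?b i t) \<in> M" unfolding split by simp
        qed
        show "M \<subseteq> range (\<lambda>w t. \<Sum>i<Suc d. w i * ?b i t)"
        proof
          fix v assume "v \<in> M"
          from red[OF this] have "(\<lambda>t. v t - v m div c * e t) \<in> range (\<lambda>w t. \<Sum>i<d. w i * b i t)" unfolding b .
          then obtain w where "(\<lambda>t. v t - v m div c * e t) = (\<lambda>t. \<Sum>i<d. w i * b i t)" by (rule imageE)
          note w = this[symmetric]
          let ?w = "w(d := v m div c)"
          have "(\<Sum>i<Suc d. ?w i * ?b i t) = v t" for t
            unfolding split using fun_cong[OF w, of t] by simp
          then show "v \<in> range (\<lambda>w t. \<Sum>i<Suc d. w i * ?b i t)" by (intro image_eqI[of _ _ ?w]) auto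
        qed
      qed
      fix w i assume z: "\<forall>t. (\<Sum>i<Suc d. w i * ?b i t) = 0" and i: "i < Suc d"
      \<comment> \<open>Coordinate \<open>m\<close> vanishes on \<open>N\<close>, so it isolates the
        coefficient of \<open>e\<close>.\<close>
      have "(\<Sum>i<d. w i * b i m) = 0" using inN[of w] by (simp add: N_def)
      moreover have "(\<Sum>i<d. w i * b i m) + w d * e m = 0" using z unfolding split by blast
      ultimately have wd: "w d = 0" using e(2) c0 by simp
      with z have "\<forall>t. (\<Sum>i<d. w i * b i t) = 0" unfolding split by simp
      from ind[OF this] wd i show "w i = 0" by (auto simp: less_Suc_eq)
    qed
  qed
qed

text \<open>Commutativity of \<open>G\<close> comes from the injectivity of \<open>\<theta>\<close>.
  The isomorphism is built from the lattice to \<open>G\<close>, where coordinates are at hand, and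
  then inverted.\<close>

lemma iso_int_power_group:
  fixes \<theta> :: "'g \<Rightarrow> nat \<Rightarrow> int"
  assumes G: "group G"
    and add: "\<And>a b. \<lbrakk>a \<in> carrier G; b \<in> carrier G\<rbrakk> \<Longrightarrow> \<theta> (a \<otimes>\<^bsub>G\<^esub> b) = (\<lambda>i. \<theta> a i + \<theta> b i)"
    and inj: "inj_on \<theta> (carrier G)"
    and supp: "\<And>a i. \<lbrakk>a \<in> carrier G; i \<ge> m\<rbrakk> \<Longrightarrow> \<theta> a i = 0"
  shows "\<exists>d\<le>m. G \<cong> int_power_group d"
proof -
  interpret group G by (rule G)
  have one: "\<theta> \<one>\<^bsub>G\<^esub> = (\<lambda>_. 0)"
    using add[of "\<one>\<^bsub>G\<^esub>" "\<one>\<^bsub>G\<^esub>"] by (simp add: fun_eq_iff)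
  let ?M = "\<theta> ` carrier G"
  have "\<exists>d\<le>m. \<exists>b. range (\<lambda>w t. \<Sum>i<d. w i * b i t) = ?M \<and>
    (\<forall>w. (\<forall>t. (\<Sum>i<d. w i * b i t) = 0) \<longrightarrow> (\<forall>i<d. w i = (0::int)))"
  proof (rule int_subgroup_basis)
    show "(\<lambda>_. 0) \<in> ?M" using one by (metis imageI one_closed)
    fix v w assume "v \<in> ?M" "w \<in> ?M"
    then obtain a c where ac: "a \<in> carrier G" "c \<in> carrier G" "v = \<theta> a" "w = \<theta> c" by blast
    have "(\<lambda>i. \<theta> c i + \<theta> (inv\<^bsub>G\<^esub> c) i) = (\<lambda>_. 0)"
      using add[of c "inv\<^bsub>G\<^esub> c"] ac one by simp
    then have "\<theta> c i + \<theta> (inv\<^bsub>G\<^esub> c) i = 0" for i by (rule fun_cong)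
    then have "\<theta> (inv\<^bsub>G\<^esub> c) i = - \<theta> c i" for i by (simp add: eq_neg_iff_add_eq_0 add.commute)
    then have "(\<lambda>t. v t - w t) = \<theta> (a \<otimes>\<^bsub>G\<^esub> inv\<^bsub>G\<^esub> c)" using add[of a "inv\<^bsub>G\<^esub> c"] ac by simp
    then show "(\<lambda>t. v t - w t) \<in> ?M" using ac by simp
  qed (use supp in auto)
  then obtain d where d: "d \<le> m \<and> (\<exists>b. range (\<lambda>w t. \<Sum>i<d. w i * b i t) = ?M \<and>
    (\<forall>w. (\<forall>t. (\<Sum>i<d. w i * b i t) = 0) \<longrightarrow> (\<forall>i<d. w i = (0::int))))" ..
  from conjunct2[OF d] obtain b where b': "range (\<lambda>w t. \<Sum>i<d. w i * b i t) = ?M \<and>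
    (\<forall>w. (\<forall>t. (\<Sum>i<d. w i * b i t) = 0) \<longrightarrow> (\<forall>i<d. w i = (0::int)))" ..
  note b = conjunct1[OF b'] and ind = conjunct2[OF b']
  let ?L = "\<lambda>w t. \<Sum>i<d. w i * b i t"
  define \<phi> where "\<phi> w = inv_into (carrier G) \<theta> (?L w)" for w
  have \<phi>: "\<phi> w \<in> carrier G" "\<theta> (\<phi> w) = ?L w" for w
  proof -
    have "?L w \<in> ?M" using b by blast
    then show "\<phi> w \<in> carrier G" "\<theta> (\<phi> w) = ?L w" unfolding \<phi>_def by (rule inv_into_into, rule f_inv_into_f)
  qed
  have car: "carrier (int_power_group d) = {..<d} \<rightarrow>\<^sub>E UNIV"
    by (simp add: int_power_group_def product_group_def integer_group_def)
  have mul: "x \<otimes>\<^bsub>int_power_group d\<^esub> y = (\<lambda>i\<in>{..<d}. x i + y i)" for x y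
    by (simp add: int_power_group_def product_group_def integer_group_def)
  have "\<phi> \<in> iso (int_power_group d) G"
  proof (rule isoI)
    show "\<phi> \<in> hom (int_power_group d) G"
    proof (rule homI)
      fix x y assume "x \<in> carrier (int_power_group d)" "y \<in> carrier (int_power_group d)"
      have "\<theta> (\<phi> (x \<otimes>\<^bsub>int_power_group d\<^esub> y)) = \<theta> (\<phi> x \<otimes>\<^bsub>G\<^esub> \<phi> y)"
        using add[of "\<phi> x" "\<phi> y"] \<phi> by (simp add: mul distrib_right sum.distrib)
      then show "\<phi> (x \<otimes>\<^bsub>int_power_group d\<^esub> y) = \<phi> x \<otimes>\<^bsub>G\<^esub> \<phi> y"
        using inj_onD[OF inj] \<phi>(1) by simp
    qed (rule \<phi>(1))
    show "bij_betw \<phi> (carrier (int_power_group d)) (carrier G)"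
    proof (rule bij_betwI')
      fix x y assume x: "x \<in> carrier (int_power_group d)" and y: "y \<in> carrier (int_power_group d)"
      show "\<phi> x = \<phi> y \<longleftrightarrow> x = y"
      proof
        assume "\<phi> x = \<phi> y"
        then have "?L x = ?L y" using \<phi>(2) by metis
        then have "\<forall>t. (\<Sum>i<d. (x i - y i) * b i t) = 0"
          by (auto simp: left_diff_distrib sum_subtractf dest: fun_cong)
        from ind[rule_format, OF this[rule_format]] have "\<forall>i<d. x i = y i" by simp
        then show "x = y" using x y unfolding car by (intro PiE_ext[of x "{..<d}" "\<lambda>_. UNIV" y]) auto
      qed simp
    next
      fix a assume a: "a \<in> carrier G"
      then have "\<theta> a \<in> range ?L" using b by simp
      then obtain w where w: "\<theta> a = ?L w" by blast
      let ?w = "restrict w {..<d}"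
      have "\<theta> (\<phi> ?w) = \<theta> a" using \<phi>(2)[of ?w] w by simp
      then have "\<phi> ?w = a" using inj_onD[OF inj] \<phi>(1) a by blast
      moreover have "?w \<in> carrier (int_power_group d)" unfolding car by simp
      ultimately show "\<exists>x\<in>carrier (int_power_group d). a = \<phi> x" by blast
    qed (rule \<phi>(1))
  qed
  then have "int_power_group d \<cong> G" by (auto simp: is_iso_def)
  moreover have "group (int_power_group d)"
    unfolding int_power_group_def by (rule product_group) simp
  ultimately have "G \<cong> int_power_group d" by (rule group.iso_sym[rotated])
  with conjunct1[OF d] show ?thesis by blast
qed

text \<open>Elements with equal values of \<open>f\<close> share a coset, so there are no more
  cosets than values. \<open>f\<close> will record the action on finite sets.\<close>

lemma (in group) finite_rcosets_if:
  assumes K: "subgroup K G" and fin: "finite (f ` carrier G)"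
    and f: "\<And>a b. \<lbrakk>a \<in> carrier G; b \<in> carrier G; f a = f b\<rbrakk> \<Longrightarrow> a \<otimes> inv b \<in> K"
  shows "finite (rcosets K)"
proof -
  have eq: "K #> a = K #> b" if "a \<in> carrier G" "b \<in> carrier G" "f a = f b" for a b
  proof -
    have "a = (a \<otimes> inv b) \<otimes> b" using that by (simp add: m_assoc)
    then have "a \<in> K #> b" using f[OF that] unfolding r_coset_def by blast
    then show ?thesis using repr_independence[OF _ that(2) K] by metis
  qed
  have "rcosets K \<subseteq> (\<lambda>v. K #> (SOME a. a \<in> carrier G \<and> f a = v)) ` f ` carrier G"
  proof
    fix C assume "C \<in> rcosets K"
    then obtain a where a: "a \<in> carrier G" "C = K #> a" by (auto simp: RCOSETS_def)
    let ?b = "SOME b. b \<in> carrier G \<and> f b = f a"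
    have "?b \<in> carrier G \<and> f ?b = f a" by (rule someI[of _ a]) (use a in simp)
    then have "C = K #> ?b" using eq a by metis
    then show "C \<in> (\<lambda>v. K #> (SOME a. a \<in> carrier G \<and> f a = v)) ` f ` carrier G" using a(1) by blast
  qed
  then show ?thesis using fin finite_surj by blast
qed

text \<open>Schreier's argument: with finitely many representatives \<open>R\<close>, a product
  \<open>c \<otimes> s\<close> can be rewritten as a generator of \<open>K\<close> times another
  representative, so the letters of a word are absorbed one by one. Closure under inverses is
  arranged for the use of \<open>T\<close> as generators of block codes.\<close>

lemma (in group) schreier_generators:
  assumes S: "finite S" "S \<subseteq> carrier G" and K: "subgroup K G" "K \<subseteq> generate G S"
    and fin: "finite (f ` generate G S)"
    and f: "\<And>a b. \<lbrakk>a \<in> generate G S; b \<in> generate G S; f a = f b\<rbrakk> \<Longrightarrow> a \<otimes> inv b \<in> K"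
  obtains T where "finite T" "T \<subseteq> K" "\<And>g. g \<in> T \<Longrightarrow> inv g \<in> T" "K = generate G T"
proof -
  let ?H = "generate G S"
  have HC: "h \<in> carrier G" if "h \<in> ?H" for h using generate_in_carrier[OF S(2) that] .
  have invH: "inv h \<in> ?H" if "h \<in> ?H" for h using generate_m_inv_closed[OF S(2) that] .
  from finite_subset_image[OF fin order_refl] obtain R0 where R0: "R0 \<subseteq> ?H" "finite R0" "f ` ?H = f ` R0" by blast
  define R where "R = insert \<one> R0"
  have R: "finite R" "R \<subseteq> ?H" "\<one> \<in> R" using R0 generate.one by (auto simp: R_def)
  have rep: "\<exists>c\<in>R. h \<otimes> inv c \<in> K" if h: "h \<in> ?H" for h
  proof -
    have "f h \<in> f ` R0" using R0(3) h by blast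
    then obtain c where "c \<in> R0" "f h = f c" by blast
    then show ?thesis using f[OF h, of c] R0(1) by (auto simp: R_def)
  qed
  define S' where "S' = S \<union> m_inv G ` S"
  have S': "finite S'" "S' \<subseteq> ?H" using S by (auto simp: S'_def intro: generate.incl generate.inv)
  \<comment> \<open>Several members of \<open>R\<close> may represent one coset, so the final
    representative of an element of \<open>K\<close> need not be trivial; therefore
    \<open>R \<inter> K\<close> is included.\<close>
  define T0 where "T0 = ((\<lambda>(c, s, c'). c \<otimes> s \<otimes> inv c') ` (R \<times> S' \<times> R) \<union> R) \<inter> K"
  define T where "T = T0 \<union> m_inv G ` T0"
  have T0C: "T0 \<subseteq> carrier G" using K HC by (auto simp: T0_def)
  have T: "finite T" "T \<subseteq> K"
    using R(1) S'(1) subgroup.m_inv_closed[OF K(1)] by (auto simp: T_def T0_def)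
  have TC: "T \<subseteq> carrier G" using T(2) subgroup.subset[OF K(1)] by blast
  have Tinv: "inv g \<in> T" if "g \<in> T" for g
    using that T0C by (auto simp: T_def)
  have gTK: "generate G T \<subseteq> K" using generate_subgroup_incl[OF T(2) K(1)] .
  have gTC: "t \<in> carrier G" if "t \<in> generate G T" for t using generate_in_carrier[OF TC that] .
  have step1: "\<exists>t'\<in>generate G T. \<exists>c'\<in>R. t \<otimes> c \<otimes> s = t' \<otimes> c'"
    if t: "t \<in> generate G T" and c: "c \<in> R" and s: "s \<in> S'" for t c s
  proof -
    have C: "t \<in> carrier G" "c \<in> carrier G" "s \<in> carrier G"
      using gTC[OF t] HC[OF subsetD[OF R(2) c]] HC[OF subsetD[OF S'(2) s]] .
    have "c \<otimes> s \<in> ?H" using generate.eng[OF subsetD[OF R(2) c] subsetD[OF S'(2) s]] .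
    from rep[OF this] obtain c' where c': "c' \<in> R" "c \<otimes> s \<otimes> inv c' \<in> K" by blast
    then have "c \<otimes> s \<otimes> inv c' \<in> T" using c s by (auto simp: T_def T0_def intro!: image_eqI[of _ _ "(c, s, c')"])
    then have "t \<otimes> (c \<otimes> s \<otimes> inv c') \<in> generate G T" using generate.eng[OF t generate.incl] by blast
    moreover have "c' \<in> carrier G" using c' R HC by blast
    then have "t \<otimes> c \<otimes> s = t \<otimes> (c \<otimes> s \<otimes> inv c') \<otimes> c'" using C by (simp add: m_assoc)
    ultimately show ?thesis using c'(1) by blast
  qed
  have step: "\<forall>t\<in>generate G T. \<forall>c\<in>R. \<exists>t'\<in>generate G T. \<exists>c'\<in>R. t \<otimes> c \<otimes> h = t' \<otimes> c'" if "h \<in> ?H" for h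
    using that
  proof (induction h rule: generate.induct)
    case one
    show ?case
    proof (intro ballI)
      fix t c assume tc: "t \<in> generate G T" "c \<in> R"
      have "t \<otimes> c \<otimes> \<one> = t \<otimes> c" using tc gTC HC R by (meson m_closed r_one subsetD)
      with tc show "\<exists>t'\<in>generate G T. \<exists>c'\<in>R. t \<otimes> c \<otimes> \<one> = t' \<otimes> c'" by blast
    qed
  next
    case (incl s)
    then show ?case using step1 by (auto simp: S'_def)
  next
    case (inv s)
    then show ?case using step1 by (auto simp: S'_def)
  next
    case (eng h1 h2)
    show ?case
    proof (intro ballI)
      fix t c assume tc: "t \<in> generate G T" "c \<in> R"
      with eng.IH(1) obtain t1 c1 where 1: "t1 \<in> generate G T" "c1 \<in> R" "t \<otimes> c \<otimes> h1 = t1 \<otimes> c1" by blast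
      with eng.IH(2) obtain t2 c2 where 2: "t2 \<in> generate G T" "c2 \<in> R" "t1 \<otimes> c1 \<otimes> h2 = t2 \<otimes> c2" by blast
      have "t \<in> carrier G" "c \<in> carrier G" "h1 \<in> carrier G" "h2 \<in> carrier G"
        using gTC[OF tc(1)] HC[OF subsetD[OF R(2) tc(2)]] HC[OF eng.hyps(1)] HC[OF eng.hyps(2)] .
      then have "t \<otimes> c \<otimes> (h1 \<otimes> h2) = t \<otimes> c \<otimes> h1 \<otimes> h2" by (simp add: m_assoc)
      with 1(3) 2 show "\<exists>t'\<in>generate G T. \<exists>c'\<in>R. t \<otimes> c \<otimes> (h1 \<otimes> h2) = t' \<otimes> c'" by metis
    qed
  qed
  have "K \<subseteq> generate G T"
  proof
    fix h assume h: "h \<in> K"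
    then have hH: "h \<in> ?H" using K(2) by blast
    from step[OF hH] R(3) generate.one obtain t c where tc: "t \<in> generate G T" "c \<in> R" "\<one> \<otimes> \<one> \<otimes> h = t \<otimes> c" by blast
    have C: "t \<in> carrier G" "c \<in> carrier G" using gTC[OF tc(1)] HC[OF subsetD[OF R(2) tc(2)]] .
    have h': "h = t \<otimes> c" using tc(3) HC[OF hH] by simp
    then have "c = inv t \<otimes> h" using C by (simp add: inv_solve_left)
    then have "c \<in> K" using gTK tc(1) h subgroup.m_inv_closed[OF K(1)] subgroup.m_closed[OF K(1)] by blast
    then have "c \<in> T" using tc(2) by (simp add: T_def T0_def)
    then show "h \<in> generate G T" unfolding h' using generate.eng[OF tc(1) generate.incl] by blast
  qed
  with gTK have "K = generate G T" by blast
  with T Tinv that show thesis by blast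
qed

section \<open>Finitely generated groups of automorphisms\<close>

context linear_subshift
begin

lemma aut_fixes_if_fixes_orbits:
  assumes h: "h \<in> carrier aut" and x: "x \<in> X" and y: "\<And>i. i < m \<Longrightarrow> y i \<in> X \<and> h (y i) = y i"
    and near: "\<And>N. \<exists>i<m. \<exists>s. \<forall>u\<in>{-N..N}. x u = y i (s + u)"
  shows "h x = x"
proof
  fix t
  obtain r where r: "block_code X r h" using curtis_hedlund_lyndon[OF h] by blast
  obtain i s where i: "i < m" "\<forall>u\<in>{-(\<bar>t\<bar> + \<bar>r\<bar>)..\<bar>t\<bar> + \<bar>r\<bar>}. x u = y i (s + u)" using near by blast
  \<comment> \<open>\<open>r\<close> may be negative, hence \<open>\<bar>r\<bar>\<close> in the
    window and the separate case \<open>u = t\<close>.\<close>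
  have ag: "x u = sh s (y i) u" if "t - r \<le> u \<and> u \<le> t + r \<or> u = t" for u
  proof -
    have "u \<in> {-(\<bar>t\<bar> + \<bar>r\<bar>)..\<bar>t\<bar> + \<bar>r\<bar>}" unfolding atLeastAtMost_iff using that by arith
    with i(2) show ?thesis by (simp add: add.commute)
  qed
  have "h x t = h (sh s (y i)) t"
    by (rule block_codeD[OF r x]) (use y[OF i(1)] ag in auto)
  also have "\<dots> = sh s (y i) t" using aut_sh[OF h] y[OF i(1)] by simp
  also have "\<dots> = x t" using ag by simp
  finally show "h x t = x t" .
qed

text \<open>At scale \<open>6 * r\<close> only the finite set \<open>E\<close> of points fails to
  look like the \<open>y i\<close> everywhere. Asking \<open>h\<close> to fix the points of period
  \<open>p\<close> disposes of \<open>E\<close> and of all periods up to \<open>2 * r\<close>; the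
  other periodic points are governed by rigid motion.\<close>

lemma finitely_generated_kernel:
  fixes m :: nat
  assumes y: "\<And>i. i < m \<Longrightarrow> y i \<in> X" "\<And>i. i < m \<Longrightarrow> \<not> periodic (y i)"
    and dense: "\<And>x N. \<lbrakk>x \<in> X; \<not> periodic x\<rbrakk> \<Longrightarrow> \<exists>i<m. \<exists>s. \<forall>u\<in>{-N..N}. x u = y i (s + u)"
    and T: "finite T" "T \<subseteq> carrier aut" "\<And>g. g \<in> T \<Longrightarrow> inv\<^bsub>aut\<^esub> g \<in> T"
    and orb: "\<And>g i. \<lbrakk>g \<in> T; i < m\<rbrakk> \<Longrightarrow> \<exists>j. g (y i) = sh j (y i)"
  shows "\<exists>p>0. \<forall>h\<in>generate aut T.
    (\<forall>i<m. h (y i) = y i) \<longrightarrow> (\<forall>x\<in>X. sh p x = x \<longrightarrow> h x = x) \<longrightarrow> (\<forall>x\<in>X. h x = x)"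
proof -
  define J where "J g i = (SOME j. g (y i) = sh j (y i))" for g i
  have J: "g (y i) = sh (J g i) (y i)" if "g \<in> T" "i < m" for g i
    unfolding J_def using someI_ex[OF orb[OF that]] .
  from uniform_range[OF T(1,2)] obtain r0 where r0: "r0 \<ge> 1" "\<And>g. g \<in> T \<Longrightarrow> block_code X r0 g" by metis
  \<comment> \<open>One bound for the ranges of the generators and for their displacements of the
    \<open>y i\<close>.\<close>
  define r where "r = Max (insert r0 ((\<lambda>(g, i). \<bar>J g i\<bar>) ` (T \<times> {..<m})))"
  have rr0: "r \<ge> r0" unfolding r_def using T(1) by (intro Max_ge) auto
  have Jr: "\<bar>J g i\<bar> \<le> r" if "g \<in> T" "i < m" for g i
    unfolding r_def using T(1) that by (intro Max_ge) (auto intro!: image_eqI[of _ _ "(g, i)"])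
  have r1: "r \<ge> 1" using rr0 r0(1) by simp
  have code: "block_code X r g" if "g \<in> T" for g using block_code_mono[OF r0(2)[OF that] rr0] .
  define Q where "Q x \<longleftrightarrow> (\<exists>i<m. \<exists>s. \<forall>u\<in>{-(6 * r)..6 * r}. x u = y i (s + u))" for x
  define E where "E = {x \<in> X. \<exists>t. \<not> Q (sh t x)}"
  have finE: "finite E"
    unfolding E_def
  proof (rule finite_local_exceptions[where n = "6 * r"])
    show "Q x \<longleftrightarrow> Q y" if "\<forall>u\<in>{-(6 * r)..6 * r}. x u = y u" for x y
      using that unfolding Q_def by metis
    show "Q x" if "x \<in> X" "\<not> periodic x" for x using dense[OF that] unfolding Q_def by blast
  qed (use r1 in simp)
  have perE: "periodic x" if "x \<in> E" for x
  proof (rule ccontr)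
    assume "\<not> periodic x"
    then have "Q (sh t x)" for t using dense[of "sh t x"] that unfolding Q_def E_def by auto
    with that show False by (simp add: E_def)
  qed
  obtain p where p: "p > 0" "\<And>x. x \<in> E \<Longrightarrow> sh p x = x" "\<And>q. 0 < q \<Longrightarrow> q \<le> 2 * r \<Longrightarrow> q dvd p"
    using common_period[OF finE perE] by blast
  \<comment> \<open>Defined by a period and not as the complement of \<open>E\<close>, because
    automorphisms preserve periods and so map \<open>Z\<close> to itself.\<close>
  define Z where "Z = {x \<in> X. sh p x \<noteq> x}"
  show ?thesis
  proof (intro exI[of _ p] conjI ballI impI)
    show "p > 0" by (rule p(1))
    fix h x assume h: "h \<in> generate aut T" and hy': "\<forall>i<m. h (y i) = y i"
      and hF: "\<forall>x\<in>X. sh p x = x \<longrightarrow> h x = x" and x: "x \<in> X"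
    have hy: "h (y i) = y i" if "i < m" for i using hy' that by blast
    have hC: "h \<in> carrier aut" using group.generate_in_carrier[OF group_aut T(2) h] .
    consider "\<not> periodic x" | "sh p x = x" | "periodic x" "x \<in> Z" using x by (auto simp: Z_def)
    then show "h x = x"
    proof cases
      case 1
      show ?thesis by (rule aut_fixes_if_fixes_orbits[OF hC x _ dense[OF x 1]]) (use y hy in auto)
    next
      case 2
      then show ?thesis using hF x by blast
    next
      case 3
      have ZX: "z \<in> X" if "z \<in> Z" for z using that by (simp add: Z_def)
      have ZT: "g z \<in> Z" if "g \<in> T" "z \<in> Z" for g z
        using that T(2) aut_in aut_periodic_iff by (auto simp: Z_def)
      have near: "\<exists>i<m. \<exists>s. \<forall>u\<in>{-(6 * r)..6 * r}. z (a + u) = y i (s + u)" if z: "z \<in> Z" for z a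
      proof -
        have "z \<notin> E" using p(2) z by (auto simp: Z_def)
        with ZX[OF z] have "Q (sh a z)" by (auto simp: E_def)
        then show ?thesis by (simp add: Q_def add.commute)
      qed
      have np: "sh q x \<noteq> x" if "q \<in> {1..2 * r}" for q
      proof
        assume q: "sh q x = x"
        have "q dvd p" using p(3)[of q] that by simp
        then obtain c where "p = c * q" by (metis dvdE mult.commute)
        then have "sh p x = x" using sh_mult[OF q, of c] by simp
        with 3(2) show False by (simp add: Z_def)
      qed
      show ?thesis
        by (rule fixes_if_fixes_family[where T = T and r = r and m = m and y = y and J = J and Z = Z];
            (fact T r1 code y J Jr ZX ZT near h hy 3 np))
    qed
  qed
qed

lemma finitely_generated_virtually_free_abelian:
  assumes H: "finitely_generated_subgroup H aut"
  shows "\<exists>d<k. virtually (aut\<lparr>carrier := H\<rparr>) (int_power_group d)"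
proof -
  interpret aut: group aut by (rule group_aut)
  from H obtain S where S: "finite S" "S \<subseteq> carrier aut" "H = generate aut S" and sH: "subgroup H aut"
    by (auto simp: finitely_generated_subgroup_def)
  have HC: "H \<subseteq> carrier aut" using subgroup.subset[OF sH] .
  obtain m y where sep: "separated m y" and
    dense: "\<And>x N. \<lbrakk>x \<in> X; \<not> periodic x\<rbrakk> \<Longrightarrow> \<exists>j<m. \<exists>s. \<forall>u\<in>{-N..N}. x u = y j (s + u)"
    using dense_family by blast
  have y: "\<And>i. i < m \<Longrightarrow> y i \<in> X" "\<And>i. i < m \<Longrightarrow> \<not> periodic (y i)" using sep by (auto simp: separated_def)
  define Orb where "Orb x = range (\<lambda>j. sh j x)" for x :: "int \<Rightarrow> 'a"
  \<comment> \<open>Inverses, because the cosets are right cosets: if the inverses of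
    \<open>a\<close> and \<open>b\<close> send \<open>y i\<close> to one orbit, then
    \<open>a\<close> times the inverse of \<open>b\<close> preserves the orbit of
    \<open>y i\<close>.\<close>
  define f where "f h = (\<lambda>i\<in>{..<m}. Orb ((inv\<^bsub>aut\<^esub> h) (y i)))" for h
  define K1 where "K1 = {h \<in> H. \<forall>i<m. \<exists>j. h (y i) = sh j (y i)}"
  have finf: "finite (f ` H)"
  proof (rule finite_subset)
    let ?C = "\<lambda>i. (\<lambda>g. Orb (g (y i))) ` carrier aut"
    show "f ` H \<subseteq> PiE {..<m} ?C" using HC aut.inv_closed by (auto simp: f_def)
    show "finite (PiE {..<m} ?C)" unfolding Orb_def by (rule finite_PiE) (use finite_aut_orbit y in auto)
  qed
  have inv_y: "(inv\<^bsub>aut\<^esub> a) z \<in> X" if "a \<in> H" "z \<in> X" for a z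
    using aut_in[OF aut.inv_closed] that HC by blast
  have K1f: "a \<otimes>\<^bsub>aut\<^esub> inv\<^bsub>aut\<^esub> b \<in> K1" if a: "a \<in> H" and b: "b \<in> H" and eq: "f a = f b" for a b
  proof -
    have aC: "a \<in> carrier aut" "b \<in> carrier aut" using a b HC by blast+
    have "\<exists>j. (a \<otimes>\<^bsub>aut\<^esub> inv\<^bsub>aut\<^esub> b) (y i) = sh j (y i)" if i: "i < m" for i
    proof -
      have "Orb ((inv\<^bsub>aut\<^esub> a) (y i)) = Orb ((inv\<^bsub>aut\<^esub> b) (y i))" using fun_cong[OF eq, of i] i by (simp add: f_def)
      moreover have "(inv\<^bsub>aut\<^esub> b) (y i) \<in> Orb ((inv\<^bsub>aut\<^esub> b) (y i))" unfolding Orb_def by (rule range_eqI[of _ _ 0]) simp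
      ultimately obtain j where j: "(inv\<^bsub>aut\<^esub> b) (y i) = sh j ((inv\<^bsub>aut\<^esub> a) (y i))" by (auto simp: Orb_def)
      have "(a \<otimes>\<^bsub>aut\<^esub> inv\<^bsub>aut\<^esub> b) (y i) = a ((inv\<^bsub>aut\<^esub> b) (y i))"
        using aut_mult[OF aC(1) aut.inv_closed[OF aC(2)] y(1)[OF i]] .
      also have "\<dots> = sh j (a ((inv\<^bsub>aut\<^esub> a) (y i)))" unfolding j by (rule aut_sh[OF aC(1) inv_y[OF a y(1)[OF i]]])
      also have "\<dots> = sh j (y i)" using aut_inv_right[OF aC(1) y(1)[OF i]] by simp
      finally show ?thesis by blast
    qed
    moreover have "a \<otimes>\<^bsub>aut\<^esub> inv\<^bsub>aut\<^esub> b \<in> H" using subgroup.m_closed[OF sH a subgroup.m_inv_closed[OF sH b]] .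
    ultimately show ?thesis by (simp add: K1_def)
  qed
  have one_y: "\<one>\<^bsub>aut\<^esub> (y i) = sh 0 (y i)" if "i < m" for i using aut_one[OF y(1)[OF that]] by simp
  have mult_y: "(a \<otimes>\<^bsub>aut\<^esub> b) (y i) = sh (j + l) (y i)"
    if "a \<in> carrier aut" "b \<in> carrier aut" "i < m" "a (y i) = sh j (y i)" "b (y i) = sh l (y i)" for a b i j l
    using aut_mult[OF that(1,2) y(1)[OF that(3)]] aut_sh[OF that(1) y(1)[OF that(3)], of l] that(4,5)
    by (simp add: add.commute)
  have inv_shift: "(inv\<^bsub>aut\<^esub> a) (y i) = sh (- j) (y i)" if "a \<in> carrier aut" "i < m" "a (y i) = sh j (y i)" for a i j
  proof -
    have "y i = (inv\<^bsub>aut\<^esub> a) (sh j (y i))" using aut_inv_left[OF that(1) y(1)[OF that(2)]] that(3) by simp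
    also have "\<dots> = sh j ((inv\<^bsub>aut\<^esub> a) (y i))" using aut_sh[OF aut.inv_closed[OF that(1)] y(1)[OF that(2)]] .
    finally have "sh (- j) (y i) = sh (- j) (sh j ((inv\<^bsub>aut\<^esub> a) (y i)))" by (rule arg_cong)
    then show ?thesis by simp
  qed
  have sK1: "subgroup K1 aut"
  proof (rule aut.subgroupI)
    show "K1 \<subseteq> carrier aut" using HC by (auto simp: K1_def)
    have "\<exists>j. \<one>\<^bsub>aut\<^esub> (y i) = sh j (y i)" if "i < m" for i using one_y[OF that] by (rule exI[of _ 0])
    then have "\<one>\<^bsub>aut\<^esub> \<in> K1" using subgroup.one_closed[OF sH] unfolding K1_def by blast
    then show "K1 \<noteq> {}" by blast
    show "inv\<^bsub>aut\<^esub> a \<in> K1" if "a \<in> K1" for a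
      using that inv_shift HC subgroup.m_inv_closed[OF sH] unfolding K1_def by blast
    show "a \<otimes>\<^bsub>aut\<^esub> b \<in> K1" if "a \<in> K1" "b \<in> K1" for a b
      using that mult_y HC subgroup.m_closed[OF sH] unfolding K1_def by blast
  qed
  have K1H: "K1 \<subseteq> generate aut S" using S(3) by (auto simp: K1_def)
  \<comment> \<open>The rigidity argument needs generators that displace the \<open>y i\<close>, so
    finite generation is passed from \<open>H\<close> to \<open>K1\<close>.\<close>
  obtain T where T: "finite T" "T \<subseteq> K1" "\<And>g. g \<in> T \<Longrightarrow> inv\<^bsub>aut\<^esub> g \<in> T" "K1 = generate aut T"
    using aut.schreier_generators[OF S(1,2) sK1 K1H finf[unfolded S(3)] K1f[unfolded S(3)]] by blast
  have TC: "T \<subseteq> carrier aut" using T(2) subgroup.subset[OF sK1] by blast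
  have orb: "\<exists>j. g (y i) = sh j (y i)" if "g \<in> T" "i < m" for g i
    using T(2) that by (auto simp: K1_def)
  have "\<exists>p>0. \<forall>h\<in>generate aut T.
    (\<forall>i<m. h (y i) = y i) \<longrightarrow> (\<forall>x\<in>X. sh p x = x \<longrightarrow> h x = x) \<longrightarrow> (\<forall>x\<in>X. h x = x)"
    by (rule finitely_generated_kernel; fact y dense T(1) TC T(3) orb)
  then obtain p where p: "p > 0" and ker: "\<And>h. \<lbrakk>h \<in> generate aut T; \<forall>i<m. h (y i) = y i;
      \<forall>x\<in>X. sh p x = x \<longrightarrow> h x = x\<rbrakk> \<Longrightarrow> \<forall>x\<in>X. h x = x" by blast
  define F where "F = {x \<in> X. sh p x = x}"
  have finF: "finite F" unfolding F_def by (rule finite_period[OF p])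
  have FX: "x \<in> X" if "x \<in> F" for x using that by (simp add: F_def)
  have autF: "g x \<in> F" if "g \<in> carrier aut" "x \<in> F" for g x
    using that aut_in aut_periodic_iff by (auto simp: F_def)
  define K where "K = {h \<in> K1. \<forall>x\<in>F. h x = x}"
  have KC: "a \<in> carrier aut" if "a \<in> K" for a using that HC by (auto simp: K_def K1_def)
  have sK: "subgroup K aut"
  proof (rule aut.subgroupI)
    show "K \<subseteq> carrier aut" using KC by blast
    have "\<one>\<^bsub>aut\<^esub> \<in> K" using aut_one FX subgroup.one_closed[OF sK1] by (auto simp: K_def)
    then show "K \<noteq> {}" by blast
    show "inv\<^bsub>aut\<^esub> a \<in> K" if a: "a \<in> K" for a
    proof -
      have "(inv\<^bsub>aut\<^esub> a) x = x" if "x \<in> F" for x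
        using aut_inv_left[OF KC[OF a] FX[OF that]] a that by (simp add: K_def)
      then show ?thesis using a subgroup.m_inv_closed[OF sK1] by (simp add: K_def)
    qed
    show "a \<otimes>\<^bsub>aut\<^esub> b \<in> K" if a: "a \<in> K" and b: "b \<in> K" for a b
    proof -
      have "(a \<otimes>\<^bsub>aut\<^esub> b) x = x" if "x \<in> F" for x
        using aut_mult[OF KC[OF a] KC[OF b] FX[OF that]] a b that by (simp add: K_def)
      then show ?thesis using a b subgroup.m_closed[OF sK1] by (simp add: K_def)
    qed
  qed
  have KH: "K \<subseteq> H" by (auto simp: K_def K1_def)
  let ?G = "aut\<lparr>carrier := H\<rparr>"
  have groupH: "group ?G" using subgroup.subgroup_is_group[OF sH group_aut] .
  have sKH: "subgroup K ?G" using aut.subgroup_incl[OF sK sH KH] .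
  have "finite (rcosets\<^bsub>?G\<^esub> K)"
  proof (rule group.finite_rcosets_if[OF groupH sKH])
    \<comment> \<open>Besides the orbits of the \<open>y i\<close>, the value records the action on
      the finite set \<open>F\<close>, which \<open>K\<close> fixes pointwise.\<close>
    let ?f = "\<lambda>h. (f h, restrict (inv\<^bsub>aut\<^esub> h) F)"
    have "?f ` H \<subseteq> f ` H \<times> (F \<rightarrow>\<^sub>E F)" using autF[OF aut.inv_closed] HC by auto
    moreover have "finite (f ` H \<times> (F \<rightarrow>\<^sub>E F))" using finf finF by (intro finite_cartesian_product finite_PiE) auto
    ultimately show "finite (?f ` carrier ?G)" by (simp add: finite_subset)
    fix a b assume "a \<in> carrier ?G" "b \<in> carrier ?G" and eq: "?f a = ?f b"
    then have a: "a \<in> H" and b: "b \<in> H" by simp_all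
    have aC: "a \<in> carrier aut" "b \<in> carrier aut" using a b HC by blast+
    have "(a \<otimes>\<^bsub>aut\<^esub> inv\<^bsub>aut\<^esub> b) x = x" if x: "x \<in> F" for x
    proof -
      have "restrict (inv\<^bsub>aut\<^esub> a) F x = restrict (inv\<^bsub>aut\<^esub> b) F x" using eq by simp
      then have "(inv\<^bsub>aut\<^esub> a) x = (inv\<^bsub>aut\<^esub> b) x" using x by simp
      then show ?thesis
        using aut_mult[OF aC(1) aut.inv_closed[OF aC(2)] FX[OF x]] aut_inv_right[OF aC(1) FX[OF x]] by simp
    qed
    then have "a \<otimes>\<^bsub>aut\<^esub> inv\<^bsub>aut\<^esub> b \<in> K" using K1f[OF a b] eq by (simp add: K_def)
    then show "a \<otimes>\<^bsub>?G\<^esub> inv\<^bsub>?G\<^esub> b \<in> K" using aut.m_inv_consistent[OF sH b] by simp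
  qed
  moreover have "\<exists>d\<le>m. ?G\<lparr>carrier := K\<rparr> \<cong> int_power_group d"
  proof -
    \<comment> \<open>Displacements are unique since the \<open>y i\<close> are not periodic, hence
      additive. The value 0 from \<open>m\<close> on places them in a lattice of rank
      \<open>m\<close>.\<close>
    define \<theta> where "\<theta> h i = (if i < m then (SOME j. h (y i) = sh j (y i)) else 0)" for h i
    have \<theta>: "h (y i) = sh (\<theta> h i) (y i)" if "h \<in> K" "i < m" for h i
      unfolding \<theta>_def using that by (auto simp: K_def K1_def intro: someI_ex)
    have uniq: "j = l" if "sh j (y i) = sh l (y i)" "i < m" for i j l
      using sh_eq_imp_periodic[OF that(1)] y(2)[OF that(2)] by blast
    show ?thesis
    proof (rule iso_int_power_group)
      show "group (?G\<lparr>carrier := K\<rparr>)" using subgroup.subgroup_is_group[OF sK group_aut] by simp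
      show "\<theta> (a \<otimes>\<^bsub>?G\<lparr>carrier := K\<rparr>\<^esub> b) = (\<lambda>i. \<theta> a i + \<theta> b i)"
        if "a \<in> carrier (?G\<lparr>carrier := K\<rparr>)" "b \<in> carrier (?G\<lparr>carrier := K\<rparr>)" for a b
      proof
        fix i
        from that have a: "a \<in> K" and b: "b \<in> K" by simp_all
        have ab: "a \<otimes>\<^bsub>aut\<^esub> b \<in> K" using subgroup.m_closed[OF sK a b] .
        have "\<theta> (a \<otimes>\<^bsub>aut\<^esub> b) i = \<theta> a i + \<theta> b i"
        proof (cases "i < m")
          case True
          from mult_y[OF KC[OF a] KC[OF b] True \<theta>[OF a True] \<theta>[OF b True]] \<theta>[OF ab True]
          show ?thesis using uniq[OF _ True] by simp
        qed (simp add: \<theta>_def)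
        then show "\<theta> (a \<otimes>\<^bsub>?G\<lparr>carrier := K\<rparr>\<^esub> b) i = \<theta> a i + \<theta> b i" by simp
      qed
      show "inj_on \<theta> (carrier (?G\<lparr>carrier := K\<rparr>))"
      proof (rule inj_onI)
        fix a b assume "a \<in> carrier (?G\<lparr>carrier := K\<rparr>)" "b \<in> carrier (?G\<lparr>carrier := K\<rparr>)" and eq: "\<theta> a = \<theta> b"
        then have a: "a \<in> K" and b: "b \<in> K" by simp_all
        \<comment> \<open>Its displacements \<open>- \<theta> a i + \<theta> b i\<close> vanish and
          it fixes \<open>F\<close>, so \<open>ker\<close> makes it the identity on
          \<open>X\<close>.\<close>
        let ?h = "inv\<^bsub>aut\<^esub> a \<otimes>\<^bsub>aut\<^esub> b"
        have hK: "?h \<in> K" using subgroup.m_closed[OF sK subgroup.m_inv_closed[OF sK a] b] .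
        have h1: "?h \<in> generate aut T" using hK T(4) by (simp add: K_def)
        have hy: "?h (y i) = y i" if i: "i < m" for i
          using mult_y[OF aut.inv_closed[OF KC[OF a]] KC[OF b] i inv_shift[OF KC[OF a] i \<theta>[OF a i]] \<theta>[OF b i]] eq
          by simp
        have "\<forall>x\<in>X. sh p x = x \<longrightarrow> ?h x = x" using hK unfolding K_def F_def by blast
        then have hX: "\<forall>x\<in>X. ?h x = x" using ker[OF h1] hy by blast
        have "a x = b x" if x: "x \<in> X" for x
        proof -
          have "(inv\<^bsub>aut\<^esub> a) (b x) = x"
            using bspec[OF hX x] aut_mult[OF aut.inv_closed[OF KC[OF a]] KC[OF b] x] by simp
          then show ?thesis using aut_inv_right[OF KC[OF a] aut_in[OF KC[OF b] x]] by simp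
        qed
        then show "a = b" by (rule aut_eqI[OF KC[OF a] KC[OF b]])
      qed
      show "\<theta> a i = 0" if "a \<in> carrier (?G\<lparr>carrier := K\<rparr>)" "i \<ge> m" for a i using that by (simp add: \<theta>_def)
    qed
  qed
  ultimately show ?thesis
    using sKH separated_less[OF sep] unfolding virtually_def by (meson le_less_trans)
qed

end

theorem theorem1p1:
  fixes A :: "'a set" and X :: "(int \<Rightarrow> 'a) set" and k :: nat
  assumes "is_shift A X"
    and "limsup (\<lambda>n. ereal (real (complexity A X n) / real n)) < ereal (real k)"
  shows "\<forall>H. finitely_generated_subgroup H (Aut_shift A X) \<longrightarrow>
           (\<exists>d<k. virtually ((Aut_shift A X)\<lparr>carrier := H\<rparr>) (int_power_group d))"
proof -
  interpret linear_subshift A X k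
    using assms by unfold_locales
  show ?thesis using finitely_generated_virtually_free_abelian by blast
qed

end
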